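(* Let $\beta\approx1.755$ be the real number with $\beta^3=2\beta^2-\beta+1$ and let $\mu$ be the uniform Bernoulli convolution associated with $\beta$. Then $\mu$ is weak Gibbs in the following sense: there exist a continuous function $\Psi:\{0,1,2\}^{\mathbb{N}}\to\mathbb{R}$ and a sequence of positive constants $K_1,K_2,\dots$ that is sub-exponential (i.e. $\lim_{n\to+\infty}\frac1n\log K_n=0$) such that for every $\xi=\xi_1\xi_2\cdots\in\{0,1,2\}^{\mathbb{N}}$ and every $n\ge1$, $$\frac1{K_n}\le\frac{\mu\left(J_{\xi_1\cdots\xi_n}\right)}{\exp\left(\sum_{k=0}^{n-1}\Psi(\sigma^k\cdot\xi)\right)}\le K_n.$$
   Context: The uniform Bernoulli convolution $\mu$ is the distribution of the random variable $X(\omega_1\omega_2\cdots)=(\beta-1)\sum_{n\ge1}\omega_n/\beta^n$, where $\{0,1\}^{\mathbb{N}}$ carries the Bernoulli product probability with weights $(1/2,1/2)$. The Parry expansion of $x\in[0,1[$ in base $\beta$ is the unique sequence $\varepsilon_1(x)\varepsilon_2(x)\cdots\in\{0,1\}^{\mathbb{N}}$ such that for all $n\ge1$, $s_n\le x<s_n+\beta^{-n}$ with $s_n=\sum_{k=1}^n\varepsilon_k(x)\beta^{-k}$. For a finite binary word $w=\epsilon_1\cdots\epsilon_n$ set $I_w:=\{x\in[0,1[\;;\;\varepsilon_1(x)\cdots\varepsilon_n(x)=\epsilon_1\cdots\epsilon_n\}$. Put $\mathbf{m}(0)=0$, $\mathbf{m}(1)=10$, $\mathbf{m}(2)=1100$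 (binary words), and for $\xi_1\cdots\xi_n\in\{0,1,2\}^n$ let $J_{\xi_1\cdots\xi_n}:=I_{\mathbf{m}(\xi_1)\cdots\mathbf{m}(\xi_n)}$ (concatenation). $\{0,1,2\}^{\mathbb{N}}$ has the product topology, and $\sigma\cdot(\xi_1\xi_2\xi_3\cdots)=\xi_2\xi_3\cdots$ is the shift map. *)

theory Defs
  imports "HOL-Probability.Probability"
begin

text \<open>
  Sequences \<open>x\<^sub>1 x\<^sub>2 x\<^sub>3 \<dots>\<close> are functions on \<^typ>\<open>nat\<close>, shifted by one: the value at \<open>n\<close> is the
  term \<open>x\<^sub>n\<^sub>+\<^sub>1\<close>. Digits are natural numbers.
\<close>

definition bernoulli_space :: "(nat \<Rightarrow> nat) measure" where
  "bernoulli_space = (\<Pi>\<^sub>M n\<in>UNIV. uniform_count_measure {0, 1})"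

definition bernoulli_convolution :: "real \<Rightarrow> real measure" where
  "bernoulli_convolution \<beta> =
     distr bernoulli_space borel (\<lambda>\<omega>. (\<beta> - 1) * (\<Sum>n. real (\<omega> n) / \<beta> ^ Suc n))"

definition is_parry_expansion :: "real \<Rightarrow> real \<Rightarrow> (nat \<Rightarrow> nat) \<Rightarrow> bool" where
  "is_parry_expansion \<beta> x \<epsilon> \<longleftrightarrow>
     (\<forall>n. \<epsilon> n \<in> {0, 1}) \<and>
     (\<forall>n\<ge>1. (\<Sum>k<n. real (\<epsilon> k) / \<beta> ^ Suc k) \<le> x \<and>
             x < (\<Sum>k<n. real (\<epsilon> k) / \<beta> ^ Suc k) + 1 / \<beta> ^ n)"

definition parry_expansion :: "real \<Rightarrow> real \<Rightarrow> nat \<Rightarrow> nat" where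
  "parry_expansion \<beta> x = (THE \<epsilon>. is_parry_expansion \<beta> x \<epsilon>)"

text \<open>The definite description is meaningful on the unit interval for every base in \<open>]1, 2]\<close>.\<close>

lemma ex1_parry_expansion:
  assumes \<beta>: "1 < \<beta>" "\<beta> \<le> 2" and x: "0 \<le> x" "x < 1"
  shows "\<exists>!\<epsilon>. is_parry_expansion \<beta> x \<epsilon>"
proof (rule ex_ex1I)
  define r where "r = rec_nat x (\<lambda>_ y. if y * \<beta> \<ge> 1 then y * \<beta> - 1 else y * \<beta>)"
  define \<epsilon> :: "nat \<Rightarrow> nat" where "\<epsilon> n = (if r n * \<beta> \<ge> 1 then 1 else 0)" for n
  have r_0: "r 0 = x" and r_Suc: "r (Suc n) = r n * \<beta> - real (\<epsilon> n)" for n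
    by (simp_all add: r_def \<epsilon>_def)
  have r_range: "0 \<le> r n \<and> r n < 1" for n
  proof (induction n)
    case 0
    then show ?case using x by (simp add: r_0)
  next
    case (Suc n)
    then have "r n * \<beta> < 1 * \<beta>" "0 \<le> r n * \<beta>"
      using \<beta> by (intro mult_strict_right_mono mult_nonneg_nonneg; simp)+
    then have "r n * \<beta> < 2" "0 \<le> r n * \<beta>" using \<beta> by linarith+
    then show ?case by (auto simp: r_Suc \<epsilon>_def)
  qed
  have r_sum: "x - (\<Sum>k<n. real (\<epsilon> k) / \<beta> ^ Suc k) = r n / \<beta> ^ n" for n
  proof (induction n)
    case 0
    then show ?case by (simp add: r_0)
  next
    case (Suc n)
    then show ?case using \<beta> by (simp add: r_Suc field_simps)
  qed
  have "is_parry_expansion \<beta> x \<epsilon>"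
    unfolding is_parry_expansion_def
  proof (intro conjI allI impI)
    fix n
    have "0 \<le> r n / \<beta> ^ n" "r n / \<beta> ^ n < 1 / \<beta> ^ n"
      using r_range[of n] \<beta> by (auto intro!: divide_strict_right_mono)
    then show "(\<Sum>k<n. real (\<epsilon> k) / \<beta> ^ Suc k) \<le> x"
      "x < (\<Sum>k<n. real (\<epsilon> k) / \<beta> ^ Suc k) + 1 / \<beta> ^ n"
      using r_sum[of n] by linarith+
  qed (simp add: \<epsilon>_def)
  then show "\<exists>\<epsilon>. is_parry_expansion \<beta> x \<epsilon>" by blast
next
  fix a b assume a: "is_parry_expansion \<beta> x a" and b: "is_parry_expansion \<beta> x b"
  have "a n = b n" for n
  proof (induction n rule: less_induct)
    case (less n)
    define s where "s = (\<Sum>k<n. real (a k) / \<beta> ^ Suc k)"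
    have s: "s = (\<Sum>k<n. real (b k) / \<beta> ^ Suc k)"
      using less by (simp add: s_def)
    have A: "s + real (a n) / \<beta> ^ Suc n \<le> x" "x < s + real (a n) / \<beta> ^ Suc n + 1 / \<beta> ^ Suc n"
      using a[unfolded is_parry_expansion_def, THEN conjunct2, rule_format, of "Suc n"]
      by (simp_all add: s_def)
    have B: "s + real (b n) / \<beta> ^ Suc n \<le> x" "x < s + real (b n) / \<beta> ^ Suc n + 1 / \<beta> ^ Suc n"
      using b[unfolded is_parry_expansion_def, THEN conjunct2, rule_format, of "Suc n"]
      by (simp_all add: s)
    have "a n = 0 \<or> a n = 1" "b n = 0 \<or> b n = 1"
      using a b by (auto simp: is_parry_expansion_def)
    then show ?case using A B by auto
  qed
  then show "a = b" by blast
qed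

definition parry_cylinder :: "real \<Rightarrow> nat list \<Rightarrow> real set" where
  "parry_cylinder \<beta> w = {x \<in> {0..<1}. map (parry_expansion \<beta> x) [0..<length w] = w}"

definition code_word :: "nat \<Rightarrow> nat list" where
  "code_word i = (if i = 0 then [0] else if i = 1 then [1, 0] else [1, 1, 0, 0])"

definition coded_cylinder :: "real \<Rightarrow> nat list \<Rightarrow> real set" where
  "coded_cylinder \<beta> v = parry_cylinder \<beta> (concat (map code_word v))"

definition ternary_sequences :: "(nat \<Rightarrow> nat) topology" where
  "ternary_sequences = product_topology (\<lambda>_. discrete_topology {0, 1, 2}) UNIV"

definition seq_shift :: "(nat \<Rightarrow> nat) \<Rightarrow> nat \<Rightarrow> nat" where
  "seq_shift \<xi> = (\<lambda>n. \<xi> (Suc n))"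

end

theory Submission
  imports Defs "HOL-Real_Asymp.Real_Asymp"
begin

text \<open>
  Write \<open>\<mu>\<close> for the Bernoulli convolution. Since \<open>1100\<close> repeated is the quasi-greedy expansion of \<open>1\<close>, the
  cylinder of a word \<open>w\<close> over \<open>{0, 1, 2}\<close> is an affine image of the whole interval \<open>[0, 1[\<close>. Self-similarity
  expresses the mass of a translate of a cylinder by the masses of translates of the
  cylinder with the first digit removed. As \<open>\<beta>\<close> is a Pisot number, only finitely many translations occur;
  after complete code words eight of them remain. So the vector of the eight masses of the cylinder of \<open>w\<close>
  is, up to a power of two, a product of nonnegative matrices of size eight, one for each letter, applied to
  a positive vector, which may be replaced by ones (lemma \<open>measure_coded_cylinder\<close>).

  The logarithm of the mass of a cylinder is not almost additive: along \<open>10\<^sup>n\<close> and \<open>0\<^sup>n\<close> the masses are of the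
  orders \<open>n / 2 ^ n\<close> and \<open>1 / 2 ^ n\<close>. Their ratio, the natural candidate for the exponential of \<open>\<Psi>\<close>, is
  unbounded. The total mass of the eight translates is considered instead, or rather the sum \<open>m w\<close> of the
  entries of the product applied to ones. An invariant cone for the columns and inequalities for the rows give
  \<open>m u * m w / (1000 * (length u + 3)) \<le> m (u @ w) \<le> m u * m w\<close> (lemmas \<open>mass_append_lower\<close> and
  \<open>mass_append_upper\<close>), where the factor lost depends on \<open>u\<close> only and polynomially. The entry of
  the cylinder itself is at least the fraction \<open>1 / (1024 * (n + 1))\<close> of \<open>m w\<close>, where \<open>n\<close> is the length of
  the word (lemma \<open>mass_le_central\<close>). Both losses are sub-exponential.

  It remains to see that an almost additive function \<open>G\<close> of words is, up to a sublinear error, given by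
  the Birkhoff sums of a continuous function. The Birkhoff sums of \<open>G\<^sub>N / N\<close>, where \<open>G\<^sub>N\<close> is the value of
  \<open>G\<close> at the prefix of length \<open>N\<close>, are close to \<open>G\<close>. For \<open>N = 2 ^ j\<close>, the difference of two
  consecutive such averages is, up to a coboundary, \<open>(G\<^sub>2\<^sub>N - G\<^sub>N - G\<^sub>N \<circ> \<sigma>\<^sup>N) / (2 * N)\<close>, where \<open>\<sigma>\<close> is the shift.
  These functions are uniformly summable and depend on finitely many coordinates, so \<open>G\<^sub>1\<close> plus their sum is
  continuous, and it has the required Birkhoff sums.
\<close>

section \<open>Octuples of masses and the letter maps\<close>

text \<open>
  The entries of an octuple stand for the masses of eight translates of one interval, the fourth
  entry being the mass of the interval itself. Using a datatype with eight real fields in place of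
  \<open>real ^ 8\<close> turns every matrix identity below into a polynomial identity in named variables.
\<close>
datatype octuple = Oct real real real real real real real real

text \<open>
  The three nonnegative matrices that describe how the eight masses change, up to a power of two,
  when the interval is replaced by its image under the branch of the letter \<open>k\<close>; the lemma
  \<open>masses_branch\<close> below justifies the entries.
\<close>
fun letter_map :: "nat \<Rightarrow> octuple \<Rightarrow> octuple" where
  "letter_map k (Oct a b c d e f g h) =
     (if k = 0 then Oct 0 0 b (a + d) (c + f) (d + h) e g
      else if k = 1 then Oct b (a + d) (b + d + h) (c + f) f 0 0 0
      else Oct (a + d + g) (b + d + h) (a + d + g) (d + h) 0 0 0 0)"

fun dual_letter_map :: "nat \<Rightarrow> octuple \<Rightarrow> octuple" where
  "dual_letter_map k (Oct a b c d e f g h) =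
     (if k = 0 then Oct d c e (d + f) g e h f
      else if k = 1 then Oct b (a + c) d (b + c) 0 (d + e) 0 c
      else Oct (a + c) b 0 (a + b + c + d) 0 0 (a + c) (b + d))"

fun pairing :: "octuple \<Rightarrow> octuple \<Rightarrow> real" where
  "pairing (Oct a b c d e f g h) (Oct a' b' c' d' e' f' g' h') =
     a * a' + b * b' + c * c' + d * d' + e * e' + f * f' + g * g' + h * h'"

fun mass :: "octuple \<Rightarrow> real" where
  "mass (Oct a b c d e f g h) = a + b + c + d + e + f + g + h"

fun central :: "octuple \<Rightarrow> real" where
  "central (Oct a b c d e f g h) = d"

definition ones :: octuple where
  "ones = Oct 1 1 1 1 1 1 1 1"

definition word_column :: "nat list \<Rightarrow> octuple" where
  "word_column w = foldr letter_map w ones"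

definition word_row :: "nat list \<Rightarrow> octuple" where
  "word_row u = foldl (\<lambda>r k. dual_letter_map k r) ones u"

fun scale :: "real \<Rightarrow> octuple \<Rightarrow> octuple" where
  "scale t (Oct a b c d e f g h) = Oct (t * a) (t * b) (t * c) (t * d) (t * e) (t * f) (t * g) (t * h)"

fun octuple_le :: "octuple \<Rightarrow> octuple \<Rightarrow> bool" where
  "octuple_le (Oct a b c d e f g h) (Oct a' b' c' d' e' f' g' h') \<longleftrightarrow>
     a \<le> a' \<and> b \<le> b' \<and> c \<le> c' \<and> d \<le> d' \<and> e \<le> e' \<and> f \<le> f' \<and> g \<le> g' \<and> h \<le> h'"

lemma scale_1: "scale 1 v = v"
  and scale_scale: "scale s (scale t v) = scale (s * t) v"
  by (cases v; simp)+

lemma letter_map_scale: "letter_map k (scale t v) = scale t (letter_map k v)"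
  by (cases v) (simp add: algebra_simps)

lemma foldr_letter_map_scale: "foldr letter_map w (scale t v) = scale t (foldr letter_map w v)"
  by (induction w) (simp_all add: letter_map_scale)

lemma letter_map_mono: "octuple_le v v' \<Longrightarrow> octuple_le (letter_map k v) (letter_map k v')"
  by (cases v; cases v') (simp add: add_mono)

lemma foldr_letter_map_mono:
  "octuple_le v v' \<Longrightarrow> octuple_le (foldr letter_map w v) (foldr letter_map w v')"
  by (induction w) (simp_all add: letter_map_mono)

lemma word_column_Nil: "word_column [] = ones"
  and word_column_Cons: "word_column (k # w) = letter_map k (word_column w)"
  by (simp_all add: word_column_def)

lemma word_row_Nil: "word_row [] = ones"
  and word_row_snoc: "word_row (u @ [k]) = dual_letter_map k (word_row u)"
  by (simp_all add: word_row_def)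

lemma pairing_letter_map: "pairing r (letter_map k v) = pairing (dual_letter_map k r) v"
  by (cases r; cases v) (simp add: algebra_simps)

lemma pairing_ones: "pairing ones v = mass v" "pairing r ones = mass r"
  by (cases v; simp add: ones_def) (cases r; simp add: ones_def)

text \<open>
  Cutting a word in two splits the total mass into a pairing of a row, which sees the first
  part only, with a column, which sees the second part only.
\<close>
lemma pairing_row_column: "pairing (word_row u) (word_column w) = mass (word_column (u @ w))"
proof (induction u arbitrary: w rule: rev_induct)
  case Nil
  then show ?case by (simp add: word_row_Nil pairing_ones)
next
  case (snoc k u)
  have "pairing (word_row (u @ [k])) (word_column w) = pairing (word_row u) (word_column (k # w))"
    by (simp add: word_row_snoc word_column_Cons pairing_letter_map)
  then show ?case using snoc by simp
qed

lemma mass_row: "mass (word_row u) = mass (word_column u)"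
  using pairing_row_column[of u "[]"] by (simp add: word_column_Nil pairing_ones)

section \<open>An invariant cone for the columns\<close>

text \<open>
  The first of the twenty inequalities says that the total mass is at most \<open>8 * (c + f)\<close>, and this is
  the one that matters. A cone that is mapped into itself has to satisfy the inequalities obtained by
  composing this one with the letter maps as well: a letter \<open>0\<close> turns \<open>c + f\<close> into \<open>b + d + h\<close>, a further one
  into \<open>a + d + g\<close>, and so on. Modulo nonnegative combinations this process ends; the list consists of
  such compositions, with those removed that follow from the others. That the list is closed under the
  letter maps is what the lemma \<open>balanced_letter_map\<close> checks.
\<close>
fun balanced :: "octuple \<Rightarrow> bool" where
  "balanced (Oct a b c d e f g h) \<longleftrightarrow>
     a \<ge> 0 \<and> b \<ge> 0 \<and> c \<ge> 0 \<and> d \<ge> 0 \<and> e \<ge> 0 \<and> f \<ge> 0 \<and> g \<ge> 0 \<and> h \<ge> 0 \<and>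
     a + b + d + e + g + h \<le> 7 * c + 7 * f \<and>
     a + c + e + f + g \<le> 7 * b + 6 * d + 7 * h \<and>
     a + c + 2 * f \<le> 6 * b + 6 * d + 7 * h \<and>
     b + c + e + f + h \<le> 6 * a + 5 * d + 7 * g \<and>
     b + c + f + g + h \<le> 5 * a + 4 * d + 7 * e \<and>
     a + 2 * d + h \<le> 5 * b + 5 * c + 4 * f \<and>
     2 * a + g \<le> 5 * b + 2 * d + 4 * h \<and>
     c + f \<le> a + 2 * b + 3 * d + 2 * h \<and>
     b + h \<le> 3 * a + 2 * d + 2 * g \<and>
     g \<le> 2 * a + 2 * d + 2 * e \<and>
     a + d \<le> 3 * b + 2 * c + 2 * f \<and>
     e \<le> 2 * a + 2 * c + 2 * d + 2 * f \<and>
     a \<le> 2 * b + d + 2 * h \<and>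
     c + f \<le> 3 * a + b + 5 * d + 2 * h \<and>
     b \<le> 2 * a + c + 2 * d + f \<and>
     a + g \<le> 2 * b + 2 * d + 3 * h \<and>
     e \<le> 2 * a + 2 * d + 3 * g \<and>
     c + f \<le> 2 * a + 2 * d + 3 * e \<and>
     b + h \<le> 2 * a + 3 * c + d + 3 * f \<and>
     d + h \<le> b + 2 * c + 5 * f"

declare balanced.simps [simp del]

lemma balanced_ones: "balanced ones"
  by (simp add: ones_def balanced.simps)

text \<open>
  For every letter, each of the twenty inequalities of the image is a nonnegative combination of the
  inequalities of \<open>v\<close>.
\<close>
lemma balanced_letter_map:
  assumes "balanced v" shows "balanced (letter_map k v)"
proof (cases v)
  case (Oct a b c d e f g h)
  note hyp = assms[unfolded Oct balanced.simps]
  consider "k = 0" | "k = 1" | "k \<noteq> 0" "k \<noteq> 1" by blast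
  then show ?thesis
  proof cases
    case 1
    then have "letter_map k v = Oct 0 0 b (a + d) (c + f) (d + h) e g" by (simp add: Oct)
    moreover have "balanced (Oct 0 0 b (a + d) (c + f) (d + h) e g)"
      using hyp unfolding balanced.simps by (intro conjI; argo)
    ultimately show ?thesis by metis
  next
    case 2
    then have "letter_map k v = Oct b (a + d) (b + d + h) (c + f) f 0 0 0" by (simp add: Oct)
    moreover have "balanced (Oct b (a + d) (b + d + h) (c + f) f 0 0 0)"
      using hyp unfolding balanced.simps by (intro conjI; argo)
    ultimately show ?thesis by metis
  next
    case 3
    then have "letter_map k v = Oct (a + d + g) (b + d + h) (a + d + g) (d + h) 0 0 0 0"
      by (simp add: Oct)
    moreover have "balanced (Oct (a + d + g) (b + d + h) (a + d + g) (d + h) 0 0 0 0)"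
      using hyp unfolding balanced.simps by (intro conjI; argo)
    ultimately show ?thesis by metis
  qed
qed

lemma balanced_column: "balanced (word_column w)"
  by (induction w) (simp_all add: word_column_Nil word_column_Cons balanced_ones balanced_letter_map)

lemma balanced_bounds:
  assumes "balanced (Oct a b c d e f g h)"
  shows "mass (Oct a b c d e f g h) \<le> 8 * (c + f)"
    and "mass (Oct a b c d e f g h) \<le> 8 * (b + d + h)"
    and "mass (Oct a b c d e f g h) \<le> 8 * (a + d + g)"
  using assms unfolding balanced.simps mass.simps by argo+

lemma balanced_nonneg:
  assumes "balanced (Oct a b c d e f g h)"
  shows "a \<ge> 0" "b \<ge> 0" "c \<ge> 0" "d \<ge> 0" "e \<ge> 0" "f \<ge> 0" "g \<ge> 0" "h \<ge> 0"
  using assms unfolding balanced.simps by blast+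

lemma mass_letter_map_le:
  assumes "balanced v"
  shows "mass (letter_map k v) \<le> (if k = 0 \<or> k = 1 then 2 else 4) * mass v"
proof (cases v)
  case (Oct a b c d e f g h)
  show ?thesis using balanced_nonneg[OF assms[unfolded Oct]] by (simp add: Oct)
qed

section \<open>Quasi-multiplicativity of the total mass\<close>

text \<open>
  The letter \<open>0\<close> puts \<open>a + d\<close> into the fourth entry and clears the first one, so this sum is the fourth
  entry after any positive number of letters \<open>0\<close> in front of \<open>w\<close>.
\<close>
lemma column_starts_nonzero:
  assumes "w = [] \<or> hd w \<noteq> 0" and "word_column w = Oct a b c d e f g h"
  shows "mass (word_column w) \<le> 32 * (a + d)"
proof (cases w)
  case Nil
  then show ?thesis using assms by (simp add: word_column_Nil ones_def)
next
  case (Cons k y)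
  then have k: "k \<noteq> 0" using assms by simp
  obtain a' b' c' d' e' f' g' h' where v: "word_column y = Oct a' b' c' d' e' f' g' h'"
    by (cases "word_column y")
  have bal: "balanced (Oct a' b' c' d' e' f' g' h')" using balanced_column[of y] v by simp
  note bb = balanced_bounds[OF bal] and nn = balanced_nonneg[OF bal]
  have t: "mass (word_column w) \<le> (if k = 1 then 2 else 4) * mass (Oct a' b' c' d' e' f' g' h')"
    using mass_letter_map_le[OF bal, of k] k by (simp add: Cons word_column_Cons v split: if_splits)
  have "word_column w = letter_map k (Oct a' b' c' d' e' f' g' h')" by (simp add: Cons word_column_Cons v)
  then have "c' + f' \<le> a + d \<or> k \<noteq> 1 \<and> a' + d' + g' \<le> a + d"
    using assms(2) k nn by (cases "k = 1") auto
  moreover have "0 \<le> mass (Oct a' b' c' d' e' f' g' h')" using nn by simp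
  ultimately show ?thesis using t bb by (auto split: if_splits simp del: mass.simps)
qed

text \<open>
  The mass of a column is never hidden in a place that rows might miss: it sits in the fourth entry,
  or evenly in the last four (the letter \<open>0\<close> permutes these four cyclically and adds the third and the fourth
  entry to two of them, so three leading letters \<open>0\<close> suffice to fill them evenly), or evenly in the first three (for words starting with \<open>2\<close>).
  A bound on the fourth entry alone is impossible: against it the last four entries grow linearly along
  \<open>0\<^sup>n\<close>, and the first three along \<open>2\<^sup>n\<close>.
\<close>
lemma column_cases:
  assumes v: "word_column w = Oct a b c d e f g h"
  shows "mass (word_column w) \<le> 128 * d \<or> (\<forall>x\<in>{e, f, g, h}. mass (word_column w) \<le> 128 * x)
    \<or> (\<forall>x\<in>{a, b, c}. mass (word_column w) \<le> 128 * x)"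
proof (cases "w = [] \<or> hd w \<noteq> 0")
  case True
  show ?thesis
  proof (cases w)
    case Nil
    then show ?thesis using v by (simp add: word_column_Nil ones_def)
  next
    case (Cons k y)
    then have k: "k \<noteq> 0" using True by simp
    obtain a' b' c' d' e' f' g' h' where y: "word_column y = Oct a' b' c' d' e' f' g' h'"
      by (cases "word_column y")
    have bal: "balanced (Oct a' b' c' d' e' f' g' h')" using balanced_column[of y] y by simp
    note bb = balanced_bounds[OF bal]
    have t: "mass (word_column w) \<le> 4 * mass (Oct a' b' c' d' e' f' g' h')"
      using mass_letter_map_le[OF bal, of k] balanced_nonneg[OF bal]
      by (simp add: Cons word_column_Cons y split: if_splits)
    have w: "word_column w = letter_map k (Oct a' b' c' d' e' f' g' h')" by (simp add: Cons word_column_Cons y)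
    show ?thesis
    proof (cases "k = 1")
      case True
      then have "d = c' + f'" using w v by simp
      then have "mass (word_column w) \<le> 128 * d"
        using t bb(1) balanced_nonneg[OF bal] by argo
      then show ?thesis ..
    next
      case False
      then have "a = a' + d' + g'" "b = b' + d' + h'" "c = a' + d' + g'" using w v k by auto
      moreover have "0 \<le> mass (Oct a' b' c' d' e' f' g' h')"
        using balanced_nonneg[OF bal] by simp
      ultimately have "\<forall>x\<in>{a, b, c}. mass (word_column w) \<le> 128 * x"
        using t bb by (auto simp del: mass.simps)
      then show ?thesis by blast
    qed
  qed
next
  case False
  then obtain y where w: "w = 0 # y" by (cases w) auto
  have step: "\<exists>a b c d e f g h. word_column y = Oct a b c d e f g h \<and> balanced (Oct a b c d e f g h)
      \<and> word_column (0 # y) = Oct 0 0 b (a + d) (c + f) (d + h) e g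
      \<and> mass (word_column (0 # y)) \<le> 2 * mass (word_column y)" for y
  proof -
    obtain a b c d e f g h where v: "word_column y = Oct a b c d e f g h" by (cases "word_column y")
    have "word_column (0 # y) = Oct 0 0 b (a + d) (c + f) (d + h) e g" by (simp add: word_column_Cons v)
    moreover have "mass (word_column (0 # y)) \<le> 2 * mass (word_column y)"
      using mass_letter_map_le[OF balanced_column, of 0 y] by (simp add: word_column_Cons)
    ultimately show ?thesis using v balanced_column[of y] by metis
  qed
  from step[of y] obtain a1 b1 c1 d1 e1 f1 g1 h1 where
    y: "word_column y = Oct a1 b1 c1 d1 e1 f1 g1 h1" "balanced (Oct a1 b1 c1 d1 e1 f1 g1 h1)"
       "word_column (0 # y) = Oct 0 0 b1 (a1 + d1) (c1 + f1) (d1 + h1) e1 g1"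
       "mass (word_column (0 # y)) \<le> 2 * mass (word_column y)" by blast
  show ?thesis
  proof (cases "y = [] \<or> hd y \<noteq> 0")
    case True
    from column_starts_nonzero[OF this y(1)] have "mass (word_column w) \<le> 64 * d"
      using y v w by simp
    moreover have "d \<ge> 0" using balanced_nonneg(4)[OF balanced_column[of w, unfolded v]] .
    ultimately show ?thesis by simp
  next
    case False
    then obtain z where z: "y = 0 # z" by (cases y) auto
    from step[of z] obtain a2 b2 c2 d2 e2 f2 g2 h2 where
      z': "word_column z = Oct a2 b2 c2 d2 e2 f2 g2 h2" "balanced (Oct a2 b2 c2 d2 e2 f2 g2 h2)"
         "word_column (0 # z) = Oct 0 0 b2 (a2 + d2) (c2 + f2) (d2 + h2) e2 g2"
         "mass (word_column (0 # z)) \<le> 2 * mass (word_column z)" by blast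
    have yz: "a1 = 0" "b1 = 0" "c1 = b2" "d1 = a2 + d2" "e1 = c2 + f2" "f1 = d2 + h2" "g1 = e2" "h1 = g2"
      using z' y z by auto
    show ?thesis
    proof (cases "z = [] \<or> hd z \<noteq> 0")
      case True
      from column_starts_nonzero[OF this z'(1)] have "mass (word_column w) \<le> 128 * d"
        using y z' z yz v w by simp
      then show ?thesis by simp
    next
      case False
      then obtain x where x: "z = 0 # x" by (cases z) auto
      from step[of x] obtain a3 b3 c3 d3 e3 f3 g3 h3 where
        x': "word_column x = Oct a3 b3 c3 d3 e3 f3 g3 h3" "balanced (Oct a3 b3 c3 d3 e3 f3 g3 h3)"
           "word_column (0 # x) = Oct 0 0 b3 (a3 + d3) (c3 + f3) (d3 + h3) e3 g3"
           "mass (word_column (0 # x)) \<le> 2 * mass (word_column x)" by blast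
      have zx: "a2 = 0" "b2 = 0" "c2 = b3" "d2 = a3 + d3" "e2 = c3 + f3" "f2 = d3 + h3" "g2 = e3" "h2 = g3"
        using x' z' x by auto
      have m: "mass (word_column w) \<le> 2 * mass (word_column y)" "mass (word_column y) \<le> 2 * mass (word_column z)"
        "mass (word_column z) \<le> 2 * mass (word_column x)"
        using y(4) z'(4) x'(4) w z x by simp_all
      have efgh: "e = c1 + f1" "f = d1 + h1" "g = c2 + f2" "h = c3 + f3"
        using y v w yz zx by auto
      have nn: "0 \<le> e" "0 \<le> f" "0 \<le> g" "0 \<le> h"
        using balanced_nonneg[OF balanced_column[of w, unfolded v]] by simp_all
      have "mass (word_column w) \<le> 128 * e"
        using m(1) balanced_bounds(1)[OF y(2), folded y(1)] efgh(1) nn(1) by argo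
      moreover have "mass (word_column w) \<le> 128 * f"
        using m(1) balanced_bounds(2)[OF y(2), folded y(1)] efgh(2) nn(2) yz(2) by argo
      moreover have "mass (word_column w) \<le> 128 * g"
        using m balanced_bounds(1)[OF z'(2), folded z'(1)] efgh(3) nn(3) by argo
      moreover have "mass (word_column w) \<le> 128 * h"
        using m balanced_bounds(1)[OF x'(2), folded x'(1)] efgh(4) nn(4) by argo
      ultimately have "\<forall>x\<in>{e, f, g, h}. mass (word_column w) \<le> 128 * x" by simp
      then show ?thesis by simp
    qed
  qed
qed

text \<open>
  A row is controlled by its third and fourth entries. The last two inequalities say
  that the sums paired with the two exceptional places for the mass of a column are not negligible. They
  worsen with the length \<open>n\<close> because along a run of letters \<open>0\<close>, respectively \<open>2\<close>, the corresponding sum is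
  preserved while the fourth entry grows by at most this sum at each step.
\<close>
fun row_bounded :: "nat \<Rightarrow> octuple \<Rightarrow> bool" where
  "row_bounded n (Oct a b c d e f g h) \<longleftrightarrow>
     a \<ge> 0 \<and> b \<ge> 0 \<and> c \<ge> 0 \<and> d \<ge> 0 \<and> e \<ge> 0 \<and> f \<ge> 0 \<and> g \<ge> 0 \<and> h \<ge> 0 \<and>
     a \<le> d \<and> b \<le> c + d \<and> c \<le> f \<and> e \<le> d \<and> g \<le> d \<and> h \<le> d \<and> f \<le> d + 2 * c \<and>
     d \<le> (real n + 3) * (a + b + c) \<and> d \<le> (real n + 3) * (e + f + g + h)"

lemma row_bounded_dual_letter_map:
  assumes "row_bounded n r"
  shows "row_bounded (Suc n) (dual_letter_map k r)"
proof (cases r)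
  case (Oct a b c d e f g h)
  note hyp = assms[unfolded Oct row_bounded.simps]
  have L: "y \<le> (real (Suc n) + 3) * x" if "y \<le> 3 * x \<or> y \<le> (real n + 3) * x + x" "x \<ge> 0" for x y
  proof -
    have "(real (Suc n) + 3) * x = (real n + 3) * x + x" by (simp add: algebra_simps)
    moreover have "3 * x \<le> (real n + 3) * x" using that(2) by (intro mult_right_mono) auto
    ultimately show ?thesis using that by linarith
  qed
  consider "k = 0" | "k = 1" | "k \<noteq> 0" "k \<noteq> 1" by blast
  then show ?thesis
  proof cases
    case 1
    have "d + f \<le> (real (Suc n) + 3) * (d + c + e)" using hyp by (intro L) auto
    moreover have "d + f \<le> (real (Suc n) + 3) * (g + e + h + f)"
    proof (intro L disjI2)
      have "g + e + h + f = e + f + g + h" by simp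
      then show "d + f \<le> (real n + 3) * (g + e + h + f) + (g + e + h + f)"
        using hyp by (simp only:) linarith
    qed (use hyp in auto)
    ultimately show ?thesis using hyp 1 by (simp add: Oct)
  next
    case 2
    have "b + c \<le> (real (Suc n) + 3) * (b + (a + c) + d)" using hyp by (intro L) auto
    moreover have "b + c \<le> (real (Suc n) + 3) * (0 + (d + e) + 0 + c)" using hyp by (intro L) auto
    ultimately show ?thesis using hyp 2 by (simp add: Oct)
  next
    case 3
    have "a + b + c + d \<le> (real (Suc n) + 3) * ((a + c) + b + 0)"
    proof (intro L disjI2)
      have "a + c + b + 0 = a + b + c" by simp
      then show "a + b + c + d \<le> (real n + 3) * (a + c + b + 0) + (a + c + b + 0)"
        using hyp by (simp only:) linarith
    qed (use hyp in auto)
    moreover have "a + b + c + d \<le> (real (Suc n) + 3) * (0 + 0 + (a + c) + (b + d))"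
      using hyp by (intro L) auto
    ultimately show ?thesis using hyp 3 by (simp add: Oct)
  qed
qed

lemma row_bounded_row: "row_bounded (length u) (word_row u)"
proof (induction u rule: rev_induct)
  case Nil
  then show ?case by (simp add: word_row_Nil ones_def)
next
  case (snoc k u)
  then show ?case using row_bounded_dual_letter_map by (simp add: word_row_snoc)
qed

text \<open>
  The factor lost depends on the length of the first word only, however long the second word is. This
  asymmetry is what makes the logarithm of the mass almost additive in the sense needed below.
\<close>
lemma mass_append_lower:
  "mass (word_column u) * mass (word_column w) \<le> 1000 * (real (length u) + 3) * mass (word_column (u @ w))"
proof -
  obtain a b c d e f g h where v: "word_column w = Oct a b c d e f g h" by (cases "word_column w")
  obtain a' b' c' d' e' f' g' h' where r: "word_row u = Oct a' b' c' d' e' f' g' h'" by (cases "word_row u")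
  define n where "n = real (length u) + 3"
  define m where "m = mass (word_column w)"
  define P where "P = pairing (word_row u) (word_column w)"
  have n: "n \<ge> 3" by (simp add: n_def)
  have bal: "balanced (Oct a b c d e f g h)" using balanced_column[of w] v by simp
  note nn = balanced_nonneg[OF bal]
  have rb: "row_bounded (length u) (Oct a' b' c' d' e' f' g' h')"
    using row_bounded_row[of u] r by simp
  then have nn': "a' \<ge> 0" "b' \<ge> 0" "c' \<ge> 0" "d' \<ge> 0" "e' \<ge> 0" "f' \<ge> 0" "g' \<ge> 0" "h' \<ge> 0" by simp_all
  have P: "P = a' * a + b' * b + c' * c + d' * d + e' * e + f' * f + g' * g + h' * h"
    by (simp add: P_def v r)
  have prods: "a' * a \<ge> 0" "b' * b \<ge> 0" "c' * c \<ge> 0" "d' * d \<ge> 0" "e' * e \<ge> 0" "f' * f \<ge> 0"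
    "g' * g \<ge> 0" "h' * h \<ge> 0" using nn nn' by simp_all
  have m0: "m \<ge> 0" using nn by (simp add: m_def v)
  have P0: "P \<ge> 0" using prods by (simp add: P)
  have c': "c' * m \<le> 8 * P"
  proof -
    have "m \<le> 8 * (c + f)" using balanced_bounds(1)[OF bal] by (simp only: m_def v)
    then have "c' * m \<le> c' * (8 * (c + f))" using nn'(3) by (rule mult_left_mono)
    moreover have "c' * f \<le> f' * f" using rb nn by (intro mult_right_mono) auto
    moreover have "c' * (8 * (c + f)) = 8 * (c' * c) + 8 * (c' * f)" by (simp add: algebra_simps)
    ultimately have "c' * m \<le> 8 * (c' * c) + 8 * (f' * f)" by linarith
    then show ?thesis using prods unfolding P by argo
  qed
  have d': "d' * m \<le> 128 * n * P"
  proof -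
    consider "m \<le> 128 * d" | "m \<le> 128 * e" "m \<le> 128 * f" "m \<le> 128 * g" "m \<le> 128 * h"
      | "m \<le> 128 * a" "m \<le> 128 * b" "m \<le> 128 * c"
      using column_cases[OF v] by (auto simp: m_def)
    then show ?thesis
    proof cases
      case 1
      then have "d' * m \<le> d' * (128 * d)" using nn' by (intro mult_left_mono)
      also have "\<dots> = 128 * (d' * d)" by simp
      also have "\<dots> \<le> 128 * P" using prods unfolding P by argo
      also have "\<dots> \<le> 128 * n * P" using n P0 mult_right_mono[of 1 n P] by simp
      finally show ?thesis .
    next
      case 2
      have "d' * m \<le> n * (e' + f' + g' + h') * m"
        using rb m0 by (intro mult_right_mono) (auto simp: n_def)
      also have "\<dots> = n * (e' * m + f' * m + g' * m + h' * m)" by (simp add: algebra_simps)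
      also have "\<dots> \<le> n * (e' * (128 * e) + f' * (128 * f) + g' * (128 * g) + h' * (128 * h))"
        using 2 n nn' by (intro mult_left_mono add_mono) auto
      also have "\<dots> \<le> n * (128 * P)"
        using prods n unfolding P by (intro mult_left_mono; argo)
      finally show ?thesis by simp
    next
      case 3
      have "d' * m \<le> n * (a' + b' + c') * m"
        using rb m0 by (intro mult_right_mono) (auto simp: n_def)
      also have "\<dots> = n * (a' * m + b' * m + c' * m)" by (simp add: algebra_simps)
      also have "\<dots> \<le> n * (a' * (128 * a) + b' * (128 * b) + c' * (128 * c))"
        using 3 n nn' by (intro mult_left_mono add_mono) auto
      also have "\<dots> \<le> n * (128 * P)"
        using prods n unfolding P by (intro mult_left_mono; argo)
      finally show ?thesis by simp
    qed
  qed
  have "mass (word_column u) \<le> 7 * d' + 4 * c'"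
    using rb by (simp add: mass_row[symmetric] r)
  then have "mass (word_column u) * m \<le> (7 * d' + 4 * c') * m"
    using m0 by (intro mult_right_mono)
  also have "\<dots> = 7 * (d' * m) + 4 * (c' * m)" by (simp add: algebra_simps)
  also have "\<dots> \<le> 896 * n * P + 32 * P" using c' d' by simp
  also have "32 * P \<le> 32 * (n * P)" using n P0 mult_right_mono[of 1 n P] by simp
  also have "896 * n * P + 32 * (n * P) \<le> 1000 * n * P" using n P0 by simp
  finally show ?thesis by (simp add: m_def n_def P_def pairing_row_column)
qed

lemma mass_append_upper:
  "mass (word_column (u @ w)) \<le> mass (word_column u) * mass (word_column w)"
proof -
  obtain a b c d e f g h where v: "word_column w = Oct a b c d e f g h" by (cases "word_column w")
  obtain a' b' c' d' e' f' g' h' where r: "word_row u = Oct a' b' c' d' e' f' g' h'" by (cases "word_row u")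
  note nn = balanced_nonneg[OF balanced_column[of w, unfolded v]]
  have nn': "a' \<ge> 0" "b' \<ge> 0" "c' \<ge> 0" "d' \<ge> 0" "e' \<ge> 0" "f' \<ge> 0" "g' \<ge> 0" "h' \<ge> 0"
    using row_bounded_row[of u] r by simp_all
  have L: "x * y \<le> x * mass (word_column w)" if "0 \<le> x" "y \<le> mass (word_column w)" for x y
    using that by (rule mult_left_mono[rotated])
  have "pairing (word_row u) (word_column w) \<le> mass (word_row u) * mass (word_column w)"
    unfolding r v[THEN arg_cong, of "pairing _"] pairing.simps mass.simps(1)[of a'] distrib_right
    using nn nn' by (intro add_mono L) (simp_all add: v)
  then show ?thesis by (simp add: pairing_row_column mass_row)
qed

section \<open>The share of the central entry\<close>

text \<open>
  The induction needs two companions. Under the letter \<open>0\<close> the sum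
  \<open>(a + d + g) + (b + d + h) + (c + f) + (a + d + e)\<close>, which dominates the mass, increases by exactly
  \<open>a + d\<close>, while \<open>a + d\<close> is preserved and becomes the fourth entry; under the letter \<open>2\<close> the sum \<open>(a + d + g) + (b + d + h)\<close>,
  comparable to the mass in the cone, increases by \<open>2 * (d + h)\<close>, while
  \<open>d + h\<close> is preserved and becomes the fourth entry.
  In both cases the growth is linear in the length of the word. After any other letter the
  bounds restart from the cone inequalities.
\<close>
lemma mass_le_central:
  "mass (word_column w) \<le> 1024 * (real (length w) + 1) * central (word_column w)"
proof -
  have "\<exists>a b c d e f g h. word_column w = Oct a b c d e f g h \<and>
     (a + d + g) + (b + d + h) + (c + f) + (a + d + e) \<le> 96 * (real (length w) + 1) * (a + d) \<and>
     (a + d + g) + (b + d + h) \<le> 32 * (real (length w) + 1) * (d + h) \<and>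
     mass (word_column w) \<le> 1024 * (real (length w) + 1) * d"
  proof (induction w)
    case Nil
    then show ?case by (simp add: word_column_Nil ones_def)
  next
    case (Cons k w)
    then obtain a b c d e f g h where v: "word_column w = Oct a b c d e f g h"
      and 1: "(a + d + g) + (b + d + h) + (c + f) + (a + d + e) \<le> 96 * (real (length w) + 1) * (a + d)"
      and 2: "(a + d + g) + (b + d + h) \<le> 32 * (real (length w) + 1) * (d + h)" by blast
    define n where "n = real (length w) + 1"
    note hyps = 1 2
    have bal: "balanced (Oct a b c d e f g h)" using balanced_column[of w] v by simp
    note bb = balanced_bounds[OF bal, unfolded mass.simps] and nn = balanced_nonneg[OF bal]
    have n: "n \<ge> 1" by (simp add: n_def)
    have L: "y \<le> q * (n + 1) * x" if "x \<ge> 0" "q > 0" "y \<le> q * x \<or> y \<le> q * n * x + q * x" for q x y :: real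
    proof -
      have "0 \<le> q * n * x" using that by (simp add: n_def)
      then show ?thesis using that by (auto simp: algebra_simps)
    qed
    consider "k = 0" | "k = 1" | "k \<noteq> 0" "k \<noteq> 1" by blast
    then show ?case
    proof cases
      case 1
      have col: "word_column (k # w) = Oct 0 0 b (a + d) (c + f) (d + h) e g"
        by (simp add: word_column_Cons v 1)
      have "(a + d + g) + (b + d + h) + (c + f) + (a + d + e) + (a + d) \<le> 96 * (n + 1) * (a + d)"
        using hyps(1) nn n by (intro L) (auto simp: n_def)
      moreover have "(a + d) + e + ((a + d) + g) \<le> 32 * (n + 1) * ((a + d) + g)"
        using balanced_bounds(3)[OF bal] nn by (intro L) auto
      moreover have "mass (word_column (k # w)) \<le> 1024 * (n + 1) * (a + d)"
      proof -
        have "mass (word_column (k # w)) \<le> 2 * ((a + d + g) + (b + d + h) + (c + f) + (a + d + e))"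
          using nn by (simp add: col)
        also have "\<dots> \<le> 2 * (96 * n * (a + d))"
          using hyps(1) unfolding n_def by (rule mult_left_mono) simp
        also have "\<dots> \<le> 1024 * n * (a + d) + 1024 * (a + d)" using n nn by simp
        finally show ?thesis by (simp add: algebra_simps)
      qed
      ultimately show ?thesis by (simp add: col n_def algebra_simps)
    next
      case 2
      have col: "word_column (k # w) = Oct b (a + d) (b + d + h) (c + f) f 0 0 0"
        by (simp add: word_column_Cons v 2)
      have "(b + (c + f) + 0) + ((a + d) + (c + f) + 0) + ((b + d + h) + 0) + (b + (c + f) + f)
          \<le> 96 * (n + 1) * (b + (c + f))"
        using bb(1) nn by (intro L) auto
      moreover have "(b + (c + f) + 0) + ((a + d) + (c + f) + 0) \<le> 32 * (n + 1) * ((c + f) + 0)"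
        using bb(1) nn by (intro L) auto
      moreover have "mass (word_column (k # w)) \<le> 1024 * (n + 1) * (c + f)"
        using bb(1) nn by (intro L) (auto simp: col)
      ultimately show ?thesis by (simp add: col n_def algebra_simps)
    next
      case 3
      have col: "word_column (k # w) = Oct (a + d + g) (b + d + h) (a + d + g) (d + h) 0 0 0 0"
        using 3 by (simp add: word_column_Cons v)
      have "((a + d + g) + (d + h) + 0) + ((b + d + h) + (d + h) + 0) + (a + d + g) + ((a + d + g) + (d + h))
          \<le> 96 * (n + 1) * ((a + d + g) + (d + h))"
        using bb(3) nn by (intro L) auto
      moreover have "((a + d + g) + (d + h) + 0) + ((b + d + h) + (d + h) + 0)
          \<le> 32 * (n + 1) * ((d + h) + 0)"
        using hyps(2) nn by (intro L) (auto simp: n_def)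
      moreover have "mass (word_column (k # w)) \<le> 1024 * (n + 1) * (d + h)"
      proof -
        have "mass (word_column (k # w)) \<le> 4 * (8 * (b + d + h))"
          using mass_letter_map_le[OF bal, of k] 3 bb(2) by (auto simp: word_column_Cons v)
        also have "\<dots> \<le> 32 * ((a + d + g) + (b + d + h))" using nn by simp
        also have "\<dots> \<le> 32 * (32 * n * (d + h))"
          using hyps(2) unfolding n_def by (rule mult_left_mono) simp
        also have "\<dots> \<le> 1024 * (n + 1) * (d + h)" using nn by (simp add: algebra_simps)
        finally show ?thesis by simp
      qed
      ultimately show ?thesis by (simp add: col n_def algebra_simps)
    qed
  qed
  then show ?thesis by auto
qed

lemma mass_column_pos: "0 < mass (word_column w)"
proof (induction w)
  case Nil
  then show ?case by (simp add: word_column_Nil ones_def)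
next
  case (Cons k w)
  obtain a b c d e f g h where v: "word_column w = Oct a b c d e f g h" by (cases "word_column w")
  have bal: "balanced (Oct a b c d e f g h)" using balanced_column[of w] v by simp
  have "0 < c + f" "0 < b + d + h" "0 < a + d + g"
    using balanced_bounds[OF bal] Cons[unfolded v] by argo+
  then show ?case using balanced_nonneg[OF bal] by (auto simp: word_column_Cons v)
qed

lemma central_le_mass: "central (word_column w) \<le> mass (word_column w)"
proof (cases "word_column w")
  case (Oct a b c d e f g h)
  then show ?thesis using balanced_nonneg[OF balanced_column[of w, unfolded Oct]] by simp
qed

section \<open>Almost additive functions of words have continuous potentials\<close>

lemma seq_shift_funpow: "(seq_shift ^^ k) \<xi> = (\<lambda>n. \<xi> (n + k))"
  by (induction k arbitrary: \<xi>) (simp_all add: seq_shift_def funpow_Suc_right del: funpow.simps(2))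

lemma sum_shift_difference:
  fixes a :: "nat \<Rightarrow> real"
  shows "(\<Sum>k<n. a k - a (k + m)) = (\<Sum>k<m. a k - a (n + k))"
proof -
  have split: "(\<Sum>k<i + j. a k) = (\<Sum>k<i. a k) + (\<Sum>k<j. a (i + k))" for i j
    by (induction j) simp_all
  show ?thesis using split[of n m] split[of m n] by (simp add: sum_subtractf add.commute)
qed

lemma continuous_map_finite_coordinates:
  fixes f :: "(nat \<Rightarrow> 'a) \<Rightarrow> 'b::topological_space"
  assumes "\<And>\<xi> \<eta>. range \<xi> \<subseteq> A \<Longrightarrow> range \<eta> \<subseteq> A \<Longrightarrow> (\<And>i. i < n \<Longrightarrow> \<xi> i = \<eta> i) \<Longrightarrow> f \<xi> = f \<eta>"
  shows "continuous_map (product_topology (\<lambda>_. discrete_topology A) UNIV) euclidean f"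
    (is "continuous_map ?T _ _")
proof -
  have top: "topspace ?T = {\<xi>. range \<xi> \<subseteq> A}" by (auto simp: PiE_def)
  have "openin ?T {\<xi> \<in> topspace ?T. f \<xi> \<in> V}" for V
  proof (subst openin_subopen, intro ballI)
    fix \<xi> assume \<xi>: "\<xi> \<in> {\<xi> \<in> topspace ?T. f \<xi> \<in> V}"
    define U where "U = (\<Pi>\<^sub>E i\<in>UNIV. if i < n then {\<xi> i} else A)"
    have "{i. (if i < n then {\<xi> i} else A) \<noteq> topspace (discrete_topology A)} \<subseteq> {..<n}"
      by (auto split: if_splits)
    then have "openin ?T U"
      unfolding U_def using \<xi> unfolding top
      by (intro product_topology_basis) (auto intro: finite_subset)
    moreover have "\<xi> \<in> U" using \<xi> unfolding top by (auto simp: U_def)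
    moreover have "U \<subseteq> {\<xi> \<in> topspace ?T. f \<xi> \<in> V}"
    proof
      fix \<eta> assume "\<eta> \<in> U"
      then have mem: "\<eta> i \<in> (if i < n then {\<xi> i} else A)" for i unfolding U_def by (rule PiE_mem) simp
      have eq: "\<eta> i = \<xi> i" if "i < n" for i using mem[of i] that by simp
      have "\<eta> i \<in> A" for i using mem[of i] \<xi> unfolding top by (auto split: if_splits)
      then have "range \<eta> \<subseteq> A" by blast
      moreover have "f \<eta> = f \<xi>" using \<xi> eq \<open>range \<eta> \<subseteq> A\<close> unfolding top by (intro assms) auto
      ultimately show "\<eta> \<in> {\<xi> \<in> topspace ?T. f \<xi> \<in> V}" using \<xi> unfolding top by simp
    qed
    ultimately show "\<exists>U. openin ?T U \<and> \<xi> \<in> U \<and> U \<subseteq> {\<xi> \<in> topspace ?T. f \<xi> \<in> V}" by blast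
  qed
  then show ?thesis by (simp add: continuous_map_def)
qed

text \<open>
  An error that is at most \<open>\<epsilon> * n + D\<close> for every \<open>\<epsilon>\<close>, uniformly on \<open>T\<close>, has a sublinear
  uniform bound, namely its supremum.
\<close>
lemma sublinear_error:
  fixes X :: "'a \<Rightarrow> nat \<Rightarrow> real"
  assumes "\<And>\<epsilon>. \<epsilon> > 0 \<Longrightarrow> \<exists>D. \<forall>\<xi>\<in>T. \<forall>n. \<bar>X \<xi> n\<bar> \<le> \<epsilon> * real n + D"
  obtains e where "(\<lambda>n. e n / real n) \<longlonglongrightarrow> 0" "\<And>\<xi> n. \<xi> \<in> T \<Longrightarrow> \<bar>X \<xi> n\<bar> \<le> e n"
proof -
  define e where "e n = (SUP \<xi>\<in>T. \<bar>X \<xi> n\<bar>)" for n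
  show thesis
  proof (cases "T = {}")
    case True
    then show ?thesis using that[of "\<lambda>_. 0"] by simp
  next
    case False
    have bdd: "bdd_above ((\<lambda>\<xi>. \<bar>X \<xi> n\<bar>) ` T)" for n
    proof -
      obtain D where "\<forall>\<xi>\<in>T. \<forall>n. \<bar>X \<xi> n\<bar> \<le> 1 * real n + D" using assms[of 1] by auto
      then show ?thesis by (intro bdd_aboveI2[where M = "1 * real n + D"]) blast
    qed
    have le: "\<bar>X \<xi> n\<bar> \<le> e n" if "\<xi> \<in> T" for \<xi> n
      unfolding e_def by (rule cSUP_upper[OF that bdd])
    have nonneg: "0 \<le> e n" for n
      using False le[of _ n] by (meson abs_ge_zero order_trans ex_in_conv)
    have "(\<lambda>n. e n / real n) \<longlonglongrightarrow> 0"
    proof (rule LIMSEQ_I)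
      fix r :: real assume r: "0 < r"
      then obtain D where D: "\<And>\<xi> n. \<xi> \<in> T \<Longrightarrow> \<bar>X \<xi> n\<bar> \<le> r / 2 * real n + D"
        using assms[of "r / 2"] by auto
      obtain N where N: "\<bar>D\<bar> * 2 / r < real N" using reals_Archimedean2 by blast
      have "norm (e n / real n - 0) < r" if n: "n \<ge> max N 1" for n
      proof -
        have "e n \<le> r / 2 * real n + D"
          unfolding e_def using False D by (intro cSUP_least) auto
        also have "\<bar>D\<bar> * 2 / r < real n" using N n by linarith
        then have "\<bar>D\<bar> < r / 2 * real n" using r by (simp add: field_simps)
        then have "r / 2 * real n + D < r * real n" by linarith
        finally show ?thesis using n nonneg[of n] by (simp add: field_simps)
      qed
      then show "\<exists>no. \<forall>n\<ge>no. norm (e n / real n - 0) < r" by blast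
    qed
    then show ?thesis using le that by blast
  qed
qed

text \<open>
  The error may depend on the first word, but on its length only and not on the second word. The words
  that enter the construction have lengths \<open>2 ^ j\<close>, whence the form of the last assumption, which allows
  \<open>c n\<close> to grow logarithmically.
\<close>
locale almost_additive =
  fixes A :: "nat set" and G :: "nat list \<Rightarrow> real" and c :: "nat \<Rightarrow> real"
  assumes finite_alphabet: "finite A"
    and almost_additive: "set u \<subseteq> A \<Longrightarrow> set w \<subseteq> A \<Longrightarrow> \<bar>G (u @ w) - G u - G w\<bar> \<le> c (length u)"
    and summable_error: "summable (\<lambda>j. c (2 ^ j) / 2 ^ j)"
begin

definition prefix_value :: "nat \<Rightarrow> (nat \<Rightarrow> nat) \<Rightarrow> real" where
  "prefix_value n \<xi> = G (map \<xi> [0..<n])"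

definition sequences :: "(nat \<Rightarrow> nat) set" where
  "sequences = {\<xi>. range \<xi> \<subseteq> A}"

abbreviation birkhoff :: "nat \<Rightarrow> ((nat \<Rightarrow> nat) \<Rightarrow> real) \<Rightarrow> (nat \<Rightarrow> nat) \<Rightarrow> real" where
  "birkhoff n f \<xi> \<equiv> \<Sum>k<n. f ((seq_shift ^^ k) \<xi>)"

lemma shift_in_sequences: "\<xi> \<in> sequences \<Longrightarrow> (seq_shift ^^ k) \<xi> \<in> sequences"
  by (auto simp: sequences_def seq_shift_funpow)

lemma prefix_value_add:
  assumes "\<xi> \<in> sequences"
  shows "\<bar>prefix_value (m + n) \<xi> - prefix_value m \<xi> - prefix_value n ((seq_shift ^^ m) \<xi>)\<bar> \<le> c m"
proof -
  have "map \<xi> [0..<m + n] = map \<xi> [0..<m] @ map ((seq_shift ^^ m) \<xi>) [0..<n]"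
    by (rule nth_equalityI) (auto simp: nth_append seq_shift_funpow)
  moreover have "set (map \<xi> [0..<m]) \<subseteq> A" "set (map ((seq_shift ^^ m) \<xi>) [0..<n]) \<subseteq> A"
    using assms shift_in_sequences[OF assms, of m] by (auto simp: sequences_def)
  ultimately show ?thesis
    using almost_additive[of "map \<xi> [0..<m]" "map ((seq_shift ^^ m) \<xi>) [0..<n]"] by (simp add: prefix_value_def)
qed

lemma prefix_value_bounded: "\<exists>B\<ge>0. \<forall>m\<le>n. \<forall>\<xi>\<in>sequences. \<bar>prefix_value m \<xi>\<bar> \<le> B"
proof -
  have fin: "finite {w. set w \<subseteq> A \<and> length w \<le> n}"
    by (rule finite_lists_length_le[OF finite_alphabet])
  define B where "B = (\<Sum>w\<in>{w. set w \<subseteq> A \<and> length w \<le> n}. \<bar>G w\<bar>)"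
  have "\<bar>prefix_value m \<xi>\<bar> \<le> B" if "m \<le> n" "\<xi> \<in> sequences" for m \<xi>
    unfolding prefix_value_def B_def using that by (intro member_le_sum fin) (auto simp: sequences_def)
  moreover have "B \<ge> 0" by (simp add: B_def sum_nonneg)
  ultimately show ?thesis by blast
qed

lemma c_nonneg:
  assumes "A \<noteq> {}" shows "c n \<ge> 0"
proof -
  obtain a where "a \<in> A" using assms by blast
  then have "set (replicate n a) \<subseteq> A" by auto
  then show ?thesis using almost_additive[of "replicate n a" "[]"] by auto
qed

text \<open>
  Along an orbit, \<open>prefix_value N\<close> at the time \<open>k\<close> is nearly \<open>a k - a (k + N)\<close>, where \<open>a k\<close> is the value of
  the part of the prefix of length \<open>n\<close> that remains after \<open>k\<close> letters. The sum over \<open>k < n\<close> therefore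
  telescopes to \<open>N\<close> terms near the beginning, each of which is close to the value of the whole prefix.
\<close>
lemma birkhoff_average:
  assumes N: "N > 0" and "sequences \<noteq> {}"
  shows "\<exists>D. \<forall>\<xi>\<in>sequences. \<forall>n. \<bar>prefix_value n \<xi> - birkhoff n (\<lambda>\<eta>. prefix_value N \<eta> / real N) \<xi>\<bar> \<le> c N / real N * real n + D"
proof -
  have "A \<noteq> {}" using \<open>sequences \<noteq> {}\<close> by (auto simp: sequences_def)
  note c0 = c_nonneg[OF this]
  obtain B where B: "B \<ge> 0" "\<And>m \<xi>. m \<le> N \<Longrightarrow> \<xi> \<in> sequences \<Longrightarrow> \<bar>prefix_value m \<xi>\<bar> \<le> B" using prefix_value_bounded[of N] by auto
  define C where "C = (\<Sum>k<N. c k)"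
  have C: "c k \<le> C" if "k < N" for k unfolding C_def using that c0 by (intro member_le_sum) auto
  have C0: "C \<ge> 0" unfolding C_def using c0 by (intro sum_nonneg) auto
  have "\<bar>prefix_value n \<xi> - birkhoff n (\<lambda>\<eta>. prefix_value N \<eta> / real N) \<xi>\<bar> \<le> c N / real N * real n + (6 * B + C)"
    if \<xi>: "\<xi> \<in> sequences" for \<xi> n
  proof -
    define a where "a k = prefix_value (n - k) ((seq_shift ^^ k) \<xi>)" for k
    have step: "\<bar>prefix_value N ((seq_shift ^^ k) \<xi>) - (a k - a (k + N))\<bar> \<le> c N + (if k + N \<le> n then 0 else 3 * B)" for k
    proof (cases "k + N \<le> n")
      case True
      then have "n - k = N + (n - (k + N))" by simp
      then show ?thesis
        using prefix_value_add[OF shift_in_sequences[OF \<xi>, of k], of N "n - (k + N)"] True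
        by (simp add: a_def funpow_add[symmetric, THEN fun_cong, unfolded comp_def] add.commute abs_minus_commute)
    next
      case False
      have "\<bar>prefix_value N ((seq_shift ^^ k) \<xi>)\<bar> \<le> B" "\<bar>a k\<bar> \<le> B" "\<bar>a (k + N)\<bar> \<le> B"
        unfolding a_def using False by (intro B shift_in_sequences \<xi>; simp)+
      then show ?thesis using False c0[of N] by simp
    qed
    have few: "(\<Sum>k<n. if k + N \<le> n then 0 else 3 * B) \<le> real N * (3 * B)"
    proof -
      have "(\<Sum>k<n. if k + N \<le> n then 0 else 3 * B) = (\<Sum>k\<in>{k. k < n \<and> n < k + N}. 3 * B)"
        by (rule sum.mono_neutral_cong_right) auto
      also have "\<dots> = real (card {k. k < n \<and> n < k + N}) * (3 * B)" by simp
      also have "card {k. k < n \<and> n < k + N} \<le> N"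
        using card_mono[of "{n - N..<n}" "{k. k < n \<and> n < k + N}"] by fastforce
      then have "real (card {k. k < n \<and> n < k + N}) * (3 * B) \<le> real N * (3 * B)"
        using B by (intro mult_right_mono) auto
      finally show ?thesis .
    qed
    have "\<bar>(\<Sum>k<n. prefix_value N ((seq_shift ^^ k) \<xi>)) - (\<Sum>k<n. a k - a (k + N))\<bar>
        \<le> (\<Sum>k<n. c N + (if k + N \<le> n then 0 else 3 * B))"
      unfolding sum_subtractf[symmetric] by (rule order_trans[OF sum_abs sum_mono]) (rule step)
    also have "\<dots> \<le> real n * c N + real N * (3 * B)" using few by (simp add: sum.distrib)
    finally have 1: "\<bar>(\<Sum>k<n. prefix_value N ((seq_shift ^^ k) \<xi>)) - (\<Sum>k<N. a k - a (n + k))\<bar>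
        \<le> real n * c N + real N * (3 * B)" by (simp only: sum_shift_difference)
    have edge: "\<bar>(a k - a (n + k)) - prefix_value n \<xi>\<bar> \<le> 3 * B + C" if k: "k < N" for k
    proof -
      have "\<bar>a (n + k)\<bar> \<le> B" unfolding a_def by (intro B shift_in_sequences \<xi>) simp
      moreover have "\<bar>a k - prefix_value n \<xi>\<bar> \<le> 2 * B + C"
      proof (cases "k \<le> n")
        case True
        have "\<bar>prefix_value n \<xi> - prefix_value k \<xi> - a k\<bar> \<le> c k"
          using prefix_value_add[OF \<xi>, of k "n - k"] True by (simp add: a_def)
        moreover have "\<bar>prefix_value k \<xi>\<bar> \<le> B" using k by (intro B \<xi>) simp
        ultimately show ?thesis using C[OF k] B(1) by linarith
      next
        case False
        have "\<bar>a k\<bar> \<le> B" "\<bar>prefix_value n \<xi>\<bar> \<le> B"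
          unfolding a_def using False k by (intro B shift_in_sequences \<xi>; simp)+
        then show ?thesis using C0 by linarith
      qed
      ultimately show ?thesis by linarith
    qed
    have "\<bar>(\<Sum>k<N. a k - a (n + k)) - real N * prefix_value n \<xi>\<bar> = \<bar>\<Sum>k<N. (a k - a (n + k)) - prefix_value n \<xi>\<bar>"
      by (simp add: sum_subtractf)
    also have "\<dots> \<le> (\<Sum>k<N. 3 * B + C)"
      by (rule order_trans[OF sum_abs sum_mono]) (use edge in simp)
    finally have 2: "\<bar>(\<Sum>k<N. a k - a (n + k)) - real N * prefix_value n \<xi>\<bar> \<le> real N * (3 * B + C)" by simp
    have "\<bar>(\<Sum>k<n. prefix_value N ((seq_shift ^^ k) \<xi>)) - real N * prefix_value n \<xi>\<bar>
        \<le> real n * c N + real N * (6 * B + C)"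
      using 1 2 by (simp add: distrib_left)
    then have "\<bar>(\<Sum>k<n. prefix_value N ((seq_shift ^^ k) \<xi>)) - real N * prefix_value n \<xi>\<bar> / real N
        \<le> (real n * c N + real N * (6 * B + C)) / real N"
      by (rule divide_right_mono) simp
    also have "\<bar>(\<Sum>k<n. prefix_value N ((seq_shift ^^ k) \<xi>)) - real N * prefix_value n \<xi>\<bar> / real N
        = \<bar>((\<Sum>k<n. prefix_value N ((seq_shift ^^ k) \<xi>)) - real N * prefix_value n \<xi>) / real N\<bar>"
      by simp
    also have "((\<Sum>k<n. prefix_value N ((seq_shift ^^ k) \<xi>)) - real N * prefix_value n \<xi>) / real N
        = birkhoff n (\<lambda>\<eta>. prefix_value N \<eta> / real N) \<xi> - prefix_value n \<xi>"
      using N by (simp add: diff_divide_distrib sum_divide_distrib)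
    finally show ?thesis using N by (simp add: add_divide_distrib abs_minus_commute mult.commute)
  qed
  then show ?thesis by blast
qed

text \<open>
  Since \<open>prefix_value N / N\<close> approximates with an error of relative size \<open>c N / N\<close>, one would like to let \<open>N\<close> tend
  to infinity, but these averages need not converge. The correction is cohomologous to the
  difference of the averages for \<open>2 ^ Suc j\<close> and \<open>2 ^ j\<close>; in contrast to this
  difference it is small at every point, by almost additivity, so the corrections can be summed.
\<close>
definition correction :: "nat \<Rightarrow> (nat \<Rightarrow> nat) \<Rightarrow> real" where
  "correction j \<xi> = (prefix_value (2 ^ Suc j) \<xi> - prefix_value (2 ^ j) \<xi> - prefix_value (2 ^ j) ((seq_shift ^^ (2 ^ j)) \<xi>)) / 2 ^ Suc j"

definition potential :: "(nat \<Rightarrow> nat) \<Rightarrow> real" where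
  "potential \<xi> = prefix_value 1 \<xi> + (\<Sum>j. correction j \<xi>)"

lemma correction_bound:
  assumes "\<xi> \<in> sequences"
  shows "\<bar>correction j \<xi>\<bar> \<le> c (2 ^ j) / 2 ^ j"
proof -
  have "\<bar>prefix_value (2 ^ Suc j) \<xi> - prefix_value (2 ^ j) \<xi> - prefix_value (2 ^ j) ((seq_shift ^^ (2 ^ j)) \<xi>)\<bar> \<le> c (2 ^ j)"
    using prefix_value_add[OF assms, of "2 ^ j" "2 ^ j"] by (simp add: mult_2)
  then have "\<bar>correction j \<xi>\<bar> \<le> c (2 ^ j) / 2 ^ Suc j"
    unfolding correction_def abs_divide by (simp add: divide_right_mono)
  also have "\<dots> \<le> c (2 ^ j) / 2 ^ j"
  proof -
    have "A \<noteq> {}" using assms by (auto simp: sequences_def)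
    then show ?thesis using c_nonneg[of "2 ^ j"] by (simp add: field_simps)
  qed
  finally show ?thesis .
qed

lemma potential_tail:
  assumes "\<xi> \<in> sequences"
  shows "\<bar>potential \<xi> - (prefix_value 1 \<xi> + (\<Sum>j<J. correction j \<xi>))\<bar> \<le> (\<Sum>j. c (2 ^ (j + J)) / 2 ^ (j + J))"
proof -
  have s: "summable (\<lambda>j. \<bar>correction j \<xi>\<bar>)"
    by (rule summable_comparison_test'[OF summable_error]) (simp add: correction_bound[OF assms])
  then have s': "summable (\<lambda>j. correction j \<xi>)" by (rule summable_rabs_cancel)
  have "potential \<xi> - (prefix_value 1 \<xi> + (\<Sum>j<J. correction j \<xi>)) = (\<Sum>j. correction (j + J) \<xi>)"
    using suminf_split_initial_segment[OF s', of J] by (simp add: potential_def)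
  also have "\<bar>\<dots>\<bar> \<le> (\<Sum>j. \<bar>correction (j + J) \<xi>\<bar>)"
    by (rule summable_rabs) (rule summable_ignore_initial_segment[OF s])
  also have "\<dots> \<le> (\<Sum>j. c (2 ^ (j + J)) / 2 ^ (j + J))"
    by (intro suminf_le correction_bound assms summable_ignore_initial_segment[OF s]
        summable_ignore_initial_segment[OF summable_error])
  finally show ?thesis .
qed

lemma tail_tendsto_0: "(\<lambda>J. \<Sum>j. c (2 ^ (j + J)) / 2 ^ (j + J)) \<longlonglongrightarrow> 0"
  by (rule suminf_exist_split2[OF summable_error])

lemma continuous_potential:
  "continuous_map (product_topology (\<lambda>_. discrete_topology A) UNIV) euclideanreal potential"
proof -
  let ?X = "product_topology (\<lambda>_. discrete_topology A) UNIV :: (nat \<Rightarrow> nat) topology"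
  have top: "topspace ?X = sequences" by (auto simp: sequences_def PiE_def)
  have prefix_value: "continuous_map ?X euclideanreal (prefix_value n)" for n
  proof (rule continuous_map_finite_coordinates[where n = n])
    show "prefix_value n \<xi> = prefix_value n \<eta>" if "\<And>i. i < n \<Longrightarrow> \<xi> i = \<eta> i" for \<xi> \<eta>
      using that by (auto simp: prefix_value_def intro!: arg_cong[where f = G])
  qed
  have prefix_value': "continuous_map ?X euclideanreal (\<lambda>\<xi>. prefix_value n ((seq_shift ^^ m) \<xi>))" for m n
  proof (rule continuous_map_finite_coordinates[where n = "n + m"])
    show "prefix_value n ((seq_shift ^^ m) \<xi>) = prefix_value n ((seq_shift ^^ m) \<eta>)" if "\<And>i. i < n + m \<Longrightarrow> \<xi> i = \<eta> i" for \<xi> \<eta>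
      using that by (auto simp: prefix_value_def seq_shift_funpow intro!: arg_cong[where f = G])
  qed
  have corr: "continuous_map ?X euclideanreal (correction j)" for j
    unfolding correction_def by (intro continuous_intros prefix_value prefix_value') auto
  have "continuous_map ?X Met_TC.mtopology potential"
  proof (rule Met_TC.continuous_map_uniform_limit[where F = sequentially
        and f = "\<lambda>J \<xi>. prefix_value 1 \<xi> + (\<Sum>j<J. correction j \<xi>)"])
    show "\<forall>\<^sub>F J in sequentially. continuous_map ?X Met_TC.mtopology (\<lambda>\<xi>. prefix_value 1 \<xi> + (\<Sum>j<J. correction j \<xi>))"
      by (intro always_eventually allI) (simp, intro continuous_intros prefix_value corr, auto)
    fix \<epsilon> :: real assume "0 < \<epsilon>"
    then have "\<forall>\<^sub>F J in sequentially. (\<Sum>j. c (2 ^ (j + J)) / 2 ^ (j + J)) < \<epsilon>"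
      using order_tendstoD(2)[OF tail_tendsto_0] by blast
    then show "\<forall>\<^sub>F J in sequentially. \<forall>\<xi>\<in>topspace ?X. potential \<xi> \<in> UNIV
        \<and> dist (prefix_value 1 \<xi> + (\<Sum>j<J. correction j \<xi>)) (potential \<xi>) < \<epsilon>"
    proof eventually_elim
      case (elim J)
      then show ?case using potential_tail[of _ J] unfolding top dist_real_def
        by (auto simp: abs_minus_commute intro: le_less_trans)
    qed
  qed simp
  then show ?thesis by simp
qed

text \<open>
  The difference of the two sides is a Birkhoff sum of a coboundary, of the shift iterated
  \<open>2 ^ j\<close> times, and telescopes.
\<close>
lemma birkhoff_correction:
  "\<exists>D. \<forall>\<xi>\<in>sequences. \<forall>n. \<bar>birkhoff n (correction j) \<xi>
     - (birkhoff n (\<lambda>\<eta>. prefix_value (2 ^ Suc j) \<eta> / 2 ^ Suc j) \<xi> - birkhoff n (\<lambda>\<eta>. prefix_value (2 ^ j) \<eta> / 2 ^ j) \<xi>)\<bar> \<le> D"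
proof -
  define N :: nat where "N = 2 ^ j"
  have N: "N > 0" by (simp add: N_def)
  obtain B where B: "B \<ge> 0" "\<And>\<xi>. \<xi> \<in> sequences \<Longrightarrow> \<bar>prefix_value N \<xi>\<bar> \<le> B" using prefix_value_bounded[of N] by auto
  have "\<bar>birkhoff n (correction j) \<xi>
     - (birkhoff n (\<lambda>\<eta>. prefix_value (2 ^ Suc j) \<eta> / 2 ^ Suc j) \<xi> - birkhoff n (\<lambda>\<eta>. prefix_value (2 ^ j) \<eta> / 2 ^ j) \<xi>)\<bar> \<le> B"
    if \<xi>: "\<xi> \<in> sequences" for \<xi> n
  proof -
    define a where "a k = prefix_value N ((seq_shift ^^ k) \<xi>)" for k
    have "birkhoff n (correction j) \<xi>
     - (birkhoff n (\<lambda>\<eta>. prefix_value (2 ^ Suc j) \<eta> / 2 ^ Suc j) \<xi> - birkhoff n (\<lambda>\<eta>. prefix_value (2 ^ j) \<eta> / 2 ^ j) \<xi>)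
     = (\<Sum>k<n. (a k - a (k + N)) / (2 * real N))"
      unfolding sum_subtractf[symmetric]
    proof (rule sum.cong[OF refl])
      fix k
      have "prefix_value (2 ^ j) ((seq_shift ^^ 2 ^ j) ((seq_shift ^^ k) \<xi>)) = a (k + N)"
        by (simp add: a_def N_def seq_shift_funpow add_ac)
      moreover have "prefix_value (2 ^ j) ((seq_shift ^^ k) \<xi>) = a k" by (simp add: a_def N_def)
      moreover have "2 ^ Suc j = 2 * real N" "2 ^ j = real N" by (simp_all add: N_def)
      ultimately show "correction j ((seq_shift ^^ k) \<xi>)
          - (prefix_value (2 ^ Suc j) ((seq_shift ^^ k) \<xi>) / 2 ^ Suc j - prefix_value (2 ^ j) ((seq_shift ^^ k) \<xi>) / 2 ^ j)
          = (a k - a (k + N)) / (2 * real N)"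
        using N unfolding correction_def by (simp only:) (simp add: field_simps)
    qed
    also have "\<dots> = (\<Sum>k<N. (a k - a (n + k)) / (2 * real N))"
      by (simp only: sum_divide_distrib[symmetric] sum_shift_difference)
    also have "\<bar>\<dots>\<bar> \<le> (\<Sum>k<N. B / real N)"
    proof (rule order_trans[OF sum_abs sum_mono])
      fix k
      have "\<bar>a k\<bar> \<le> B" "\<bar>a (n + k)\<bar> \<le> B" unfolding a_def by (intro B shift_in_sequences \<xi>)+
      then have "\<bar>a k - a (n + k)\<bar> / (2 * real N) \<le> (2 * B) / (2 * real N)"
        by (intro divide_right_mono) linarith+
      then show "\<bar>(a k - a (n + k)) / (2 * real N)\<bar> \<le> B / real N" by simp
    qed
    also have "\<dots> = B" using N by simp
    finally show ?thesis .
  qed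
  then show ?thesis by blast
qed

lemma birkhoff_partial_potential:
  "\<exists>D. \<forall>\<xi>\<in>sequences. \<forall>n. \<bar>birkhoff n (\<lambda>\<eta>. prefix_value 1 \<eta> + (\<Sum>j<J. correction j \<eta>)) \<xi>
     - birkhoff n (\<lambda>\<eta>. prefix_value (2 ^ J) \<eta> / 2 ^ J) \<xi>\<bar> \<le> D"
proof (induction J)
  case 0
  then show ?case by (intro exI[of _ 0]) simp
next
  case (Suc J)
  then obtain D where D: "\<And>\<xi> n. \<xi> \<in> sequences \<Longrightarrow> \<bar>birkhoff n (\<lambda>\<eta>. prefix_value 1 \<eta> + (\<Sum>j<J. correction j \<eta>)) \<xi>
     - birkhoff n (\<lambda>\<eta>. prefix_value (2 ^ J) \<eta> / 2 ^ J) \<xi>\<bar> \<le> D" by blast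
  obtain D' where D': "\<And>\<xi> n. \<xi> \<in> sequences \<Longrightarrow> \<bar>birkhoff n (correction J) \<xi>
     - (birkhoff n (\<lambda>\<eta>. prefix_value (2 ^ Suc J) \<eta> / 2 ^ Suc J) \<xi> - birkhoff n (\<lambda>\<eta>. prefix_value (2 ^ J) \<eta> / 2 ^ J) \<xi>)\<bar> \<le> D'"
    using birkhoff_correction[of J] by blast
  have "\<bar>birkhoff n (\<lambda>\<eta>. prefix_value 1 \<eta> + (\<Sum>j<Suc J. correction j \<eta>)) \<xi>
     - birkhoff n (\<lambda>\<eta>. prefix_value (2 ^ Suc J) \<eta> / 2 ^ Suc J) \<xi>\<bar> \<le> D + D'" if \<xi>: "\<xi> \<in> sequences" for \<xi> n
  proof -
    have "birkhoff n (\<lambda>\<eta>. prefix_value 1 \<eta> + (\<Sum>j<Suc J. correction j \<eta>)) \<xi>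
        = birkhoff n (\<lambda>\<eta>. prefix_value 1 \<eta> + (\<Sum>j<J. correction j \<eta>)) \<xi> + birkhoff n (correction J) \<xi>"
      by (simp add: sum.distrib)
    then show ?thesis using D[OF \<xi>, of n] D'[OF \<xi>, of n] by linarith
  qed
  then show ?case by blast
qed

lemma potential_approximates:
  obtains e where "(\<lambda>n. e n / real n) \<longlonglongrightarrow> 0"
    "\<And>\<xi> n. range \<xi> \<subseteq> A \<Longrightarrow> \<bar>G (map \<xi> [0..<n]) - (\<Sum>k<n. potential ((seq_shift ^^ k) \<xi>))\<bar> \<le> e n"
proof -
  have approx: "\<exists>D. \<forall>\<xi>\<in>sequences. \<forall>n. \<bar>prefix_value n \<xi> - birkhoff n potential \<xi>\<bar> \<le> \<epsilon> * real n + D" if \<epsilon>: "\<epsilon> > 0" for \<epsilon>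
  proof (cases "sequences = {}")
    case False
    have "\<forall>\<^sub>F J in sequentially. (\<Sum>j. c (2 ^ (j + J)) / 2 ^ (j + J)) < \<epsilon> / 2 \<and> c (2 ^ J) / 2 ^ J < \<epsilon> / 2"
      using \<epsilon> by (intro eventually_conj order_tendstoD(2)[OF tail_tendsto_0]
          order_tendstoD(2)[OF summable_LIMSEQ_zero[OF summable_error]]) auto
    then obtain J where J: "(\<Sum>j. c (2 ^ (j + J)) / 2 ^ (j + J)) < \<epsilon> / 2" "c (2 ^ J) / 2 ^ J < \<epsilon> / 2"
      unfolding eventually_sequentially by blast
    obtain D where D: "\<And>\<xi> n. \<xi> \<in> sequences \<Longrightarrow>
        \<bar>prefix_value n \<xi> - birkhoff n (\<lambda>\<eta>. prefix_value (2 ^ J) \<eta> / 2 ^ J) \<xi>\<bar> \<le> c (2 ^ J) / 2 ^ J * real n + D"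
      using birkhoff_average[of "2 ^ J"] False by auto
    obtain D' where D': "\<And>\<xi> n. \<xi> \<in> sequences \<Longrightarrow> \<bar>birkhoff n (\<lambda>\<eta>. prefix_value 1 \<eta> + (\<Sum>j<J. correction j \<eta>)) \<xi>
       - birkhoff n (\<lambda>\<eta>. prefix_value (2 ^ J) \<eta> / 2 ^ J) \<xi>\<bar> \<le> D'"
      using birkhoff_partial_potential[of J] by blast
    have "\<bar>prefix_value n \<xi> - birkhoff n potential \<xi>\<bar> \<le> \<epsilon> * real n + (D + D')" if \<xi>: "\<xi> \<in> sequences" for \<xi> n
    proof -
      have "\<bar>birkhoff n potential \<xi> - birkhoff n (\<lambda>\<eta>. prefix_value 1 \<eta> + (\<Sum>j<J. correction j \<eta>)) \<xi>\<bar>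
          \<le> (\<Sum>k<n. \<epsilon> / 2)"
        unfolding sum_subtractf[symmetric]
        by (rule order_trans[OF sum_abs sum_mono])
          (rule order_trans[OF potential_tail[OF shift_in_sequences[OF \<xi>]] less_imp_le[OF J(1)]])
      moreover have "c (2 ^ J) / 2 ^ J * real n \<le> \<epsilon> / 2 * real n"
        using J by (intro mult_right_mono) auto
      moreover have "(\<Sum>k<n. \<epsilon> / 2) = \<epsilon> / 2 * real n" by simp
      moreover have "\<epsilon> * real n = \<epsilon> / 2 * real n + \<epsilon> / 2 * real n" by (simp add: field_simps)
      ultimately show ?thesis using D[OF \<xi>, of n] D'[OF \<xi>, of n] by linarith
    qed
    then show ?thesis by blast
  qed simp
  show thesis
  proof (rule sublinear_error[OF approx])
    fix e assume "(\<lambda>n. e n / real n) \<longlonglongrightarrow> 0"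
      "\<And>\<xi> n. \<xi> \<in> sequences \<Longrightarrow> \<bar>prefix_value n \<xi> - birkhoff n potential \<xi>\<bar> \<le> e n"
    then show thesis by (intro that[of e]) (simp_all add: sequences_def prefix_value_def)
  qed
qed

end

section \<open>Self-similarity of the Bernoulli convolution\<close>

lemma uniform_bit_prob_space: "prob_space (uniform_count_measure {0, 1 :: nat})"
  by (rule prob_space_uniform_count_measure) auto

lemma space_bernoulli_space: "space bernoulli_space = {\<omega>. \<forall>n. \<omega> n \<in> {0, 1}}"
  by (auto simp: bernoulli_space_def space_PiM PiE_def Pi_def uniform_count_measure_def space_point_measure)

lemma prob_space_bernoulli_space: "prob_space bernoulli_space"
proof -
  interpret product_prob_space "\<lambda>_. uniform_count_measure {0, 1 :: nat}" "UNIV :: nat set"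
    by (intro product_prob_spaceI uniform_bit_prob_space)
  show ?thesis unfolding bernoulli_space_def by (rule prob_space_axioms)
qed

text \<open>
  Conditioning on the first of the independent digits.
\<close>
lemma emeasure_bernoulli_space_split:
  assumes "A \<in> sets bernoulli_space"
  shows "emeasure bernoulli_space A =
    (\<Sum>s\<in>{0, 1}. ennreal (1/2) * emeasure bernoulli_space {\<omega> \<in> space bernoulli_space. case_nat s \<omega> \<in> A})"
proof -
  let ?M = "uniform_count_measure {0, 1 :: nat}"
  interpret M: prob_space ?M by (rule uniform_bit_prob_space)
  interpret sequence_space ?M ..
  have S: "bernoulli_space = S" by (simp add: bernoulli_space_def)
  interpret B: prob_space bernoulli_space by (rule prob_space_bernoulli_space)
  let ?f = "\<lambda>(s, \<omega>). case_nat s \<omega>"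
  have meas[measurable]: "?f \<in> measurable (?M \<Otimes>\<^sub>M S) S" by measurable
  have "emeasure bernoulli_space A = emeasure (distr (?M \<Otimes>\<^sub>M S) S ?f) A"
    unfolding S PiM_iter ..
  also have "\<dots> = emeasure (?M \<Otimes>\<^sub>M S) (?f -` A \<inter> space (?M \<Otimes>\<^sub>M S))"
    using assms by (intro emeasure_distr meas) (simp add: S)
  also have "\<dots> = (\<integral>\<^sup>+ s. emeasure S (Pair s -` (?f -` A \<inter> space (?M \<Otimes>\<^sub>M S))) \<partial>?M)"
    using assms measurable_sets[OF meas] by (intro B.emeasure_pair_measure_alt[unfolded S]) (auto simp: S)
  also have "\<dots> = (\<Sum>s\<in>{0, 1}. ennreal (1/2) * emeasure S (Pair s -` (?f -` A \<inter> space (?M \<Otimes>\<^sub>M S))))"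
    unfolding uniform_count_measure_def by (subst nn_integral_point_measure_finite) (auto simp: mult.commute)
  also have "\<dots> = (\<Sum>s\<in>{0, 1}. ennreal (1/2) * emeasure bernoulli_space {\<omega> \<in> space bernoulli_space. case_nat s \<omega> \<in> A})"
    unfolding S
    by (intro sum.cong refl arg_cong2[where f = "(*)"] arg_cong2[where f = emeasure])
       (auto simp: space_pair_measure uniform_count_measure_def space_point_measure)
  finally show ?thesis .
qed

locale cubic_base =
  fixes \<beta> :: real
  assumes cubic: "\<beta> ^ 3 = 2 * \<beta> ^ 2 - \<beta> + 1"
begin

text \<open>
  The equation reads \<open>\<beta> * (\<beta> - 1)\<^sup>2 = 1\<close>, and the left-hand side is increasing for \<open>\<beta> > 1\<close>.
  The enclosure is narrow enough to locate all the translations that occur below with respect to \<open>[-1, 1]\<close>.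
\<close>
lemma base_bounds: "1.7548 < \<beta>" "\<beta> < 1.7549"
proof -
  have eq: "\<beta> * (\<beta> - 1) ^ 2 = 1"
    using cubic by (simp add: power2_eq_square power3_eq_cube algebra_simps)
  have pos: "0 < \<beta>"
  proof (rule ccontr)
    assume "\<not> 0 < \<beta>"
    then have "\<beta> * (\<beta> - 1) ^ 2 \<le> 0" by (intro mult_nonpos_nonneg) auto
    then show False using eq by simp
  qed
  have gt1: "1 < \<beta>"
  proof (rule ccontr)
    assume "\<not> 1 < \<beta>"
    then have "(1 - \<beta>) ^ 2 \<le> 1 ^ 2" using pos by (intro power_mono) auto
    then have "\<beta> * (\<beta> - 1) ^ 2 \<le> \<beta> * 1" using pos by (intro mult_left_mono) (auto simp: power2_commute)
    then have "\<beta> = 1" using eq \<open>\<not> 1 < \<beta>\<close> by simp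
    then show False using eq by simp
  qed
  show "1.7548 < \<beta>"
  proof (rule ccontr)
    assume "\<not> 1.7548 < \<beta>"
    then have "\<beta> * (\<beta> - 1) ^ 2 \<le> 1.7548 * 0.7548 ^ 2"
      using gt1 by (intro mult_mono power_mono) auto
    then show False using eq by (simp add: power2_eq_square)
  qed
  show "\<beta> < 1.7549"
  proof (rule ccontr)
    assume "\<not> \<beta> < 1.7549"
    then have "1.7549 * 0.7549 ^ 2 \<le> \<beta> * (\<beta> - 1) ^ 2"
      by (intro mult_mono power_mono) auto
    then show False using eq by (simp add: power2_eq_square)
  qed
qed

lemma base_gt_1: "1 < \<beta>" and base_pos: "0 < \<beta>" and base_le_2: "\<beta> \<le> 2"
  using base_bounds by auto

lemma base_sq_bounds: "3.0793 < \<beta> * \<beta>" "\<beta> * \<beta> < 3.0797"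
proof -
  have "1.7548 * 1.7548 \<le> \<beta> * \<beta>" using base_bounds by (intro mult_mono) auto
  then show "3.0793 < \<beta> * \<beta>" by simp
  have "\<beta> * \<beta> \<le> 1.7549 * 1.7549" using base_bounds by (intro mult_mono) auto
  then show "\<beta> * \<beta> < 3.0797" by simp
qed

lemma base_cube: "\<beta> * (\<beta> * \<beta>) = 2 * (\<beta> * \<beta>) - \<beta> + 1"
  using cubic by (simp add: power2_eq_square power3_eq_cube mult.assoc)

abbreviation \<mu> :: "real measure" where "\<mu> \<equiv> bernoulli_convolution \<beta>"

definition digit_sum :: "(nat \<Rightarrow> nat) \<Rightarrow> real" where
  "digit_sum \<omega> = (\<beta> - 1) * (\<Sum>n. real (\<omega> n) / \<beta> ^ Suc n)"

lemma digit_le_1: "\<omega> \<in> space bernoulli_space \<Longrightarrow> real (\<omega> n) \<le> 1"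
proof -
  assume "\<omega> \<in> space bernoulli_space"
  then have "\<omega> n \<in> {0, 1}" unfolding space_bernoulli_space by blast
  then show ?thesis by auto
qed

lemma geometric_base: "(\<lambda>n. 1 / \<beta> ^ Suc n) sums (1 / (\<beta> - 1))"
proof -
  have "(\<lambda>n. (1 / \<beta>) * (1 / \<beta>) ^ n) sums ((1 / \<beta>) * (1 / (1 - 1 / \<beta>)))"
    using base_gt_1 by (intro sums_mult geometric_sums) auto
  then show ?thesis using base_gt_1 by (simp add: field_simps)
qed

lemma summable_digits:
  assumes "\<omega> \<in> space bernoulli_space"
  shows "summable (\<lambda>n. real (\<omega> n) / \<beta> ^ Suc n)"
proof (rule summable_comparison_test'[OF sums_summable[OF geometric_base]])
  fix n
  have "real (\<omega> n) \<le> 1" by (rule digit_le_1[OF assms])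
  then show "norm (real (\<omega> n) / \<beta> ^ Suc n) \<le> 1 / \<beta> ^ Suc n"
    using base_pos by (simp add: divide_right_mono)
qed

lemma digit_sum_range:
  assumes "\<omega> \<in> space bernoulli_space"
  shows "0 \<le> digit_sum \<omega>" "digit_sum \<omega> \<le> 1"
proof -
  have "0 \<le> (\<Sum>n. real (\<omega> n) / \<beta> ^ Suc n)"
    using base_pos by (intro suminf_nonneg summable_digits assms) auto
  then show "0 \<le> digit_sum \<omega>" using base_gt_1 by (simp add: digit_sum_def)
  have "real (\<omega> n) \<le> 1" for n by (rule digit_le_1[OF assms])
  then have "(\<Sum>n. real (\<omega> n) / \<beta> ^ Suc n) \<le> (\<Sum>n. 1 / \<beta> ^ Suc n)"
    using base_pos
    by (intro suminf_le summable_digits assms sums_summable[OF geometric_base] divide_right_mono) auto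
  also have "\<dots> = 1 / (\<beta> - 1)" using geometric_base by (rule sums_unique[symmetric])
  finally show "digit_sum \<omega> \<le> 1" using base_gt_1 by (simp add: digit_sum_def field_simps)
qed

lemma digit_sum_case_nat:
  assumes "\<omega> \<in> space bernoulli_space" "s \<in> {0, 1}"
  shows "digit_sum (case_nat s \<omega>) = (digit_sum \<omega> + (\<beta> - 1) * real s) / \<beta>"
proof -
  have "case_nat s \<omega> \<in> space bernoulli_space"
    using assms by (auto simp: space_bernoulli_space split: nat.split)
  from suminf_split_head[OF summable_digits[OF this]]
  have "(\<Sum>n. real (case_nat s \<omega> n) / \<beta> ^ Suc n) = (\<Sum>n. real (\<omega> n) / \<beta> ^ Suc n / \<beta>) + real s / \<beta>"
    by (simp add: field_simps)
  also have "(\<Sum>n. real (\<omega> n) / \<beta> ^ Suc n / \<beta>) = (\<Sum>n. real (\<omega> n) / \<beta> ^ Suc n) / \<beta>"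
    by (rule suminf_divide[OF summable_digits[OF assms(1)]])
  finally show ?thesis by (simp add: digit_sum_def add_divide_distrib ring_distribs)
qed

lemma measurable_digit_sum [measurable]: "digit_sum \<in> borel_measurable bernoulli_space"
proof -
  have [measurable]: "(\<lambda>\<omega>. real (\<omega> n)) \<in> borel_measurable bernoulli_space" for n
  proof -
    have "(\<lambda>\<omega>. \<omega> n) \<in> measurable bernoulli_space (uniform_count_measure {0, 1})"
      unfolding bernoulli_space_def by measurable
    moreover have "real \<in> borel_measurable (uniform_count_measure {0, 1})"
      by (auto simp: measurable_def uniform_count_measure_def space_point_measure sets_point_measure)
    ultimately show ?thesis by (rule measurable_compose)
  qed
  show ?thesis unfolding digit_sum_def by measurable
qed

lemma measure_\<mu>:
  assumes "A \<in> sets borel"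
  shows "measure \<mu> A = measure bernoulli_space {\<omega> \<in> space bernoulli_space. digit_sum \<omega> \<in> A}"
  unfolding bernoulli_convolution_def digit_sum_def[symmetric]
  using assms by (subst measure_distr[OF measurable_digit_sum]) (auto intro!: arg_cong2[where f = measure])

lemma sets_\<mu> [simp]: "sets \<mu> = sets borel" and space_\<mu> [simp]: "space \<mu> = UNIV"
  by (simp_all add: bernoulli_convolution_def)

sublocale prob_space \<mu>
  unfolding bernoulli_convolution_def digit_sum_def[symmetric]
  by (rule prob_space.prob_space_distr[OF prob_space_bernoulli_space measurable_digit_sum])

lemma self_similar:
  assumes A: "A \<in> sets borel"
  shows "measure \<mu> A = (measure \<mu> {x. x / \<beta> \<in> A} + measure \<mu> {x. (x + (\<beta> - 1)) / \<beta> \<in> A}) / 2"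
proof -
  interpret B: prob_space bernoulli_space by (rule prob_space_bernoulli_space)
  let ?B = "bernoulli_space"
  define D where "D = {\<omega> \<in> space ?B. digit_sum \<omega> \<in> A}"
  have D: "D \<in> sets ?B" using A unfolding D_def by measurable
  have m: "{x. (x + (\<beta> - 1) * real s) / \<beta> \<in> A} \<in> sets borel" for s
  proof -
    have "(\<lambda>x. (x + (\<beta> - 1) * real s) / \<beta>) \<in> borel_measurable borel" by measurable
    from measurable_sets[OF this A] show ?thesis by (simp add: vimage_def)
  qed
  have E: "{\<omega> \<in> space ?B. case_nat s \<omega> \<in> D}
      = {\<omega> \<in> space ?B. digit_sum \<omega> \<in> {x. (x + (\<beta> - 1) * real s) / \<beta> \<in> A}}" if "s \<in> {0, 1}" for s
  proof -
    have "case_nat s \<omega> \<in> space ?B" if "\<omega> \<in> space ?B" for \<omega>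
      using that \<open>s \<in> {0, 1}\<close> by (auto simp: space_bernoulli_space split: nat.split)
    then show ?thesis using digit_sum_case_nat[OF _ that] by (auto simp: D_def)
  qed
  have "ennreal (measure \<mu> A) = emeasure ?B D"
    by (simp add: measure_\<mu>[OF A] D_def B.emeasure_eq_measure)
  also have "\<dots> = (\<Sum>s\<in>{0, 1}. ennreal (1/2) * emeasure ?B {\<omega> \<in> space ?B. case_nat s \<omega> \<in> D})"
    by (rule emeasure_bernoulli_space_split[OF D])
  also have "\<dots> = (\<Sum>s\<in>{0, 1}. ennreal (1/2) * ennreal (measure \<mu> {x. (x + (\<beta> - 1) * real s) / \<beta> \<in> A}))"
    by (intro sum.cong refl arg_cong2[where f = "(*)"]) (simp only: E B.emeasure_eq_measure measure_\<mu>[OF m])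
  also have "\<dots> = ennreal (\<Sum>s\<in>{0, 1 :: nat}. (1/2) * measure \<mu> {x. (x + (\<beta> - 1) * real s) / \<beta> \<in> A})"
  proof -
    have "(\<Sum>s\<in>{0, 1}. ennreal (1/2) * ennreal (measure \<mu> {x. (x + (\<beta> - 1) * real s) / \<beta> \<in> A}))
        = (\<Sum>s\<in>{0, 1 :: nat}. ennreal ((1/2) * measure \<mu> {x. (x + (\<beta> - 1) * real s) / \<beta> \<in> A}))"
      by (intro sum.cong refl ennreal_mult[symmetric]) auto
    also have "\<dots> = ennreal (\<Sum>s\<in>{0, 1 :: nat}. (1/2) * measure \<mu> {x. (x + (\<beta> - 1) * real s) / \<beta> \<in> A})"
      by (intro sum_ennreal) auto
    finally show ?thesis .
  qed
  finally have "measure \<mu> A = (\<Sum>s\<in>{0, 1 :: nat}. (1/2) * measure \<mu> {x. (x + (\<beta> - 1) * real s) / \<beta> \<in> A})"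
    by (subst (asm) ennreal_inj) (auto intro!: sum_nonneg)
  then show ?thesis by simp
qed

lemma measure_below_0: "measure \<mu> {..<0} = 0"
proof -
  have "{\<omega> \<in> space bernoulli_space. digit_sum \<omega> \<in> {..<0}} = {}"
    using digit_sum_range by force
  then show ?thesis by (subst measure_\<mu>) (simp, simp only: measure_empty)
qed

text \<open>
  There is no atom at \<open>1\<close>: self-similarity expresses the mass of \<open>[1, \<infinity>[\<close> as the average of
  itself and of the mass of \<open>[\<beta>, \<infinity>[\<close>, which is zero.
\<close>
lemma measure_from_1: "measure \<mu> {1..} = 0"
proof -
  have "{x. x / \<beta> \<in> {1..}} = {\<beta>..}" "{x. (x + (\<beta> - 1)) / \<beta> \<in> {1..}} = {1..}"
    using base_pos by (auto simp: field_simps)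
  moreover have "measure \<mu> {\<beta>..} = 0"
  proof -
    have "{\<omega> \<in> space bernoulli_space. digit_sum \<omega> \<in> {\<beta>..}} = {}"
      using digit_sum_range base_gt_1 by force
    then show ?thesis by (subst measure_\<mu>) (simp, simp only: measure_empty)
  qed
  ultimately show ?thesis using self_similar[of "{1..}"] by simp
qed

lemma measure_unit: "measure \<mu> {0..<1} = 1"
proof -
  have "measure \<mu> (UNIV - ({..<0} \<union> {1..})) = measure \<mu> UNIV - measure \<mu> ({..<0} \<union> {1..})"
    using finite_measure_compl[of "{..<0} \<union> {1..}"] by simp
  moreover have "measure \<mu> ({..<0} \<union> {1..}) = 0"
    using measure_below_0 measure_from_1 measure_Un_le[of "{..<0}" \<mu> "{1..}"] by (simp add: measure_le_0_iff)
  moreover have "UNIV - ({..<0 :: real} \<union> {1..}) = {0..<1}" by auto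
  ultimately show ?thesis using prob_space by simp
qed

definition shifted_mass :: "real \<Rightarrow> real \<Rightarrow> real \<Rightarrow> real" where
  "shifted_mass c d a = measure \<mu> {c + a..<d + a}"

section \<open>Eight translates suffice\<close>

text \<open>
  A digit \<open>e\<close> in front of an interval replaces the translation by \<open>a\<close> by the translations by
  \<open>\<beta> * a + e\<close> and \<open>\<beta> * a + e - (\<beta> - 1)\<close>.
\<close>
lemma shifted_mass_digit:
  assumes "\<beta> * a + e = a\<^sub>0" "\<beta> * a + e - (\<beta> - 1) = a\<^sub>1"
  shows "shifted_mass ((c + e) / \<beta>) ((d + e) / \<beta>) a = (shifted_mass c d a\<^sub>0 + shifted_mass c d a\<^sub>1) / 2"
proof -
  have "(y + e) / \<beta> + a = (y + a\<^sub>0) / \<beta>" for y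
    using base_pos by (simp add: assms(1)[symmetric] field_simps)
  moreover have "a\<^sub>0 = a\<^sub>1 + (\<beta> - 1)" using assms by simp
  ultimately have "{x. x / \<beta> \<in> {(c + e) / \<beta> + a..<(d + e) / \<beta> + a}} = {c + a\<^sub>0..<d + a\<^sub>0}"
    "{x. (x + (\<beta> - 1)) / \<beta> \<in> {(c + e) / \<beta> + a..<(d + e) / \<beta> + a}} = {c + a\<^sub>1..<d + a\<^sub>1}"
    using base_pos by (auto simp: divide_le_cancel divide_less_cancel)
  then show ?thesis unfolding shifted_mass_def by (subst self_similar) simp_all
qed

lemma shifted_mass_outside:
  assumes "0 \<le> c" "d \<le> 1" "a \<le> -1 \<or> 1 \<le> a"
  shows "shifted_mass c d a = 0"
proof -
  have "{c + a..<d + a} \<subseteq> {..<0} \<or> {c + a..<d + a} \<subseteq> {1..}" using assms by auto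
  then have "measure \<mu> {c + a..<d + a} \<le> 0"
    using finite_measure_mono[of "{c + a..<d + a}" "{..<0}"] finite_measure_mono[of "{c + a..<d + a}" "{1..}"]
      measure_below_0 measure_from_1 by auto
  then show ?thesis by (simp add: shifted_mass_def measure_le_0_iff)
qed

lemma shifted_mass_nonneg: "0 \<le> shifted_mass c d a" and shifted_mass_le_1: "shifted_mass c d a \<le> 1"
  by (simp_all add: shifted_mass_def)

text \<open>
  Starting from the translation by \<open>0\<close>, the translations that remain in \<open>]-1, 1[\<close> after arbitrary admissible
  words take the nine values below only, because \<open>\<beta>\<close> is a Pisot number; all the others carry no mass.
  The value \<open>\<beta> + 2 - \<beta> * \<beta>\<close> occurs only after the first digit of the code words \<open>10\<close> and \<open>1100\<close>, so
  it has no place in an octuple.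
\<close>
lemma shifted_mass_digit_0:
  assumes cd: "0 \<le> c" "d \<le> 1"
  defines "M \<equiv> shifted_mass c d" and "M' \<equiv> shifted_mass (c / \<beta>) (d / \<beta>)"
  shows "M' (1 - \<beta>) = 0"
    and "M' (2 * \<beta> - \<beta> * \<beta> - 1) = 0"
    and "M' (\<beta> + 1 - \<beta> * \<beta>) = M (2 * \<beta> - \<beta> * \<beta> - 1) / 2"
    and "M' (0) = (M (0) + M (1 - \<beta>)) / 2"
    and "M' (2 - \<beta>) = (M (2 * \<beta> - \<beta> * \<beta>) + M (\<beta> + 1 - \<beta> * \<beta>)) / 2"
    and "M' (2 * \<beta> - \<beta> * \<beta>) = (M (\<beta> - 1) + M (0)) / 2"
    and "M' (\<beta> * \<beta> + 1 - 2 * \<beta>) = M (2 - \<beta>) / 2"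
    and "M' (\<beta> - 1) = M (\<beta> * \<beta> + 1 - 2 * \<beta>) / 2"
    and "M' (\<beta> + 2 - \<beta> * \<beta>) = M (2 * \<beta> - \<beta> * \<beta>) / 2"
proof -
  have step: "M' a = (M a\<^sub>0 + M a\<^sub>1) / 2"
    if "\<beta> * a + 0 = a\<^sub>0" "\<beta> * a + 0 - (\<beta> - 1) = a\<^sub>1" for a a\<^sub>0 a\<^sub>1
    using shifted_mass_digit[OF that] by (simp add: M_def M'_def)
  have out: "M a = 0" if "a \<le> -1 \<or> 1 \<le> a" for a
    using shifted_mass_outside[OF cd that] by (simp add: M_def)
  show "M' (1 - \<beta>) = 0"
    using step[of "1 - \<beta>" "\<beta> - \<beta> * \<beta>" "1 - \<beta> * \<beta>"] out[of "\<beta> - \<beta> * \<beta>"] out[of "1 - \<beta> * \<beta>"]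
      base_cube base_bounds base_sq_bounds by (simp add: algebra_simps)
  show "M' (2 * \<beta> - \<beta> * \<beta> - 1) = 0"
    using step[of "2 * \<beta> - \<beta> * \<beta> - 1" "- 1" "- \<beta>"] out[of "- 1"] out[of "- \<beta>"]
      base_cube base_bounds base_sq_bounds by (simp add: algebra_simps)
  show "M' (\<beta> + 1 - \<beta> * \<beta>) = M (2 * \<beta> - \<beta> * \<beta> - 1) / 2"
    using step[of "\<beta> + 1 - \<beta> * \<beta>" "2 * \<beta> - \<beta> * \<beta> - 1" "\<beta> - \<beta> * \<beta>"] out[of "\<beta> - \<beta> * \<beta>"]
      base_cube base_bounds base_sq_bounds by (simp add: algebra_simps)
  show "M' (0) = (M (0) + M (1 - \<beta>)) / 2"
    using step[of "0" "0" "1 - \<beta>"]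
      base_cube base_bounds base_sq_bounds by (simp add: algebra_simps)
  show "M' (2 - \<beta>) = (M (2 * \<beta> - \<beta> * \<beta>) + M (\<beta> + 1 - \<beta> * \<beta>)) / 2"
    using step[of "2 - \<beta>" "2 * \<beta> - \<beta> * \<beta>" "\<beta> + 1 - \<beta> * \<beta>"]
      base_cube base_bounds base_sq_bounds by (simp add: algebra_simps)
  show "M' (2 * \<beta> - \<beta> * \<beta>) = (M (\<beta> - 1) + M (0)) / 2"
    using step[of "2 * \<beta> - \<beta> * \<beta>" "\<beta> - 1" "0"]
      base_cube base_bounds base_sq_bounds by (simp add: algebra_simps)
  show "M' (\<beta> * \<beta> + 1 - 2 * \<beta>) = M (2 - \<beta>) / 2"
    using step[of "\<beta> * \<beta> + 1 - 2 * \<beta>" "1" "2 - \<beta>"] out[of "1"]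
      base_cube base_bounds base_sq_bounds by (simp add: algebra_simps)
  show "M' (\<beta> - 1) = M (\<beta> * \<beta> + 1 - 2 * \<beta>) / 2"
    using step[of "\<beta> - 1" "\<beta> * \<beta> - \<beta>" "\<beta> * \<beta> + 1 - 2 * \<beta>"] out[of "\<beta> * \<beta> - \<beta>"]
      base_cube base_bounds base_sq_bounds by (simp add: algebra_simps)
  show "M' (\<beta> + 2 - \<beta> * \<beta>) = M (2 * \<beta> - \<beta> * \<beta>) / 2"
    using step[of "\<beta> + 2 - \<beta> * \<beta>" "3 * \<beta> - \<beta> * \<beta> - 1" "2 * \<beta> - \<beta> * \<beta>"] out[of "3 * \<beta> - \<beta> * \<beta> - 1"]
      base_cube base_bounds base_sq_bounds by (simp add: algebra_simps)
qed

lemma shifted_mass_digit_1: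
  assumes cd: "0 \<le> c" "d \<le> 1"
  defines "M \<equiv> shifted_mass c d" and "M' \<equiv> shifted_mass ((c + 1) / \<beta>) ((d + 1) / \<beta>)"
  shows "M' (1 - \<beta>) = M (\<beta> + 1 - \<beta> * \<beta>) / 2"
    and "M' (2 * \<beta> - \<beta> * \<beta> - 1) = (M (0) + M (1 - \<beta>)) / 2"
    and "M' (\<beta> + 1 - \<beta> * \<beta>) = (M (2 * \<beta> - \<beta> * \<beta>) + M (\<beta> + 1 - \<beta> * \<beta>)) / 2"
    and "M' (0) = M (2 - \<beta>) / 2"
    and "M' (2 - \<beta>) = M (\<beta> + 2 - \<beta> * \<beta>) / 2"
    and "M' (2 * \<beta> - \<beta> * \<beta>) = 0"
    and "M' (\<beta> * \<beta> + 1 - 2 * \<beta>) = 0"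
    and "M' (\<beta> - 1) = 0"
    and "M' (\<beta> + 2 - \<beta> * \<beta>) = 0"
proof -
  have step: "M' a = (M a\<^sub>0 + M a\<^sub>1) / 2"
    if "\<beta> * a + 1 = a\<^sub>0" "\<beta> * a + 1 - (\<beta> - 1) = a\<^sub>1" for a a\<^sub>0 a\<^sub>1
    using shifted_mass_digit[OF that] by (simp add: M_def M'_def)
  have out: "M a = 0" if "a \<le> -1 \<or> 1 \<le> a" for a
    using shifted_mass_outside[OF cd that] by (simp add: M_def)
  show "M' (1 - \<beta>) = M (\<beta> + 1 - \<beta> * \<beta>) / 2"
    using step[of "1 - \<beta>" "\<beta> + 1 - \<beta> * \<beta>" "2 - \<beta> * \<beta>"] out[of "2 - \<beta> * \<beta>"]
      base_cube base_bounds base_sq_bounds by (simp add: algebra_simps)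
  show "M' (2 * \<beta> - \<beta> * \<beta> - 1) = (M (0) + M (1 - \<beta>)) / 2"
    using step[of "2 * \<beta> - \<beta> * \<beta> - 1" "0" "1 - \<beta>"]
      base_cube base_bounds base_sq_bounds by (simp add: algebra_simps)
  show "M' (\<beta> + 1 - \<beta> * \<beta>) = (M (2 * \<beta> - \<beta> * \<beta>) + M (\<beta> + 1 - \<beta> * \<beta>)) / 2"
    using step[of "\<beta> + 1 - \<beta> * \<beta>" "2 * \<beta> - \<beta> * \<beta>" "\<beta> + 1 - \<beta> * \<beta>"]
      base_cube base_bounds base_sq_bounds by (simp add: algebra_simps)
  show "M' (0) = M (2 - \<beta>) / 2"
    using step[of "0" "1" "2 - \<beta>"] out[of "1"]
      base_cube base_bounds base_sq_bounds by (simp add: algebra_simps)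
  show "M' (2 - \<beta>) = M (\<beta> + 2 - \<beta> * \<beta>) / 2"
    using step[of "2 - \<beta>" "2 * \<beta> + 1 - \<beta> * \<beta>" "\<beta> + 2 - \<beta> * \<beta>"] out[of "2 * \<beta> + 1 - \<beta> * \<beta>"]
      base_cube base_bounds base_sq_bounds by (simp add: algebra_simps)
  show "M' (2 * \<beta> - \<beta> * \<beta>) = 0"
    using step[of "2 * \<beta> - \<beta> * \<beta>" "\<beta>" "1"] out[of "\<beta>"] out[of "1"]
      base_cube base_bounds base_sq_bounds by (simp add: algebra_simps)
  show "M' (\<beta> * \<beta> + 1 - 2 * \<beta>) = 0"
    using step[of "\<beta> * \<beta> + 1 - 2 * \<beta>" "2" "3 - \<beta>"] out[of "2"] out[of "3 - \<beta>"]
      base_cube base_bounds base_sq_bounds by (simp add: algebra_simps)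
  show "M' (\<beta> - 1) = 0"
    using step[of "\<beta> - 1" "\<beta> * \<beta> + 1 - \<beta>" "\<beta> * \<beta> + 2 - 2 * \<beta>"] out[of "\<beta> * \<beta> + 1 - \<beta>"] out[of "\<beta> * \<beta> + 2 - 2 * \<beta>"]
      base_cube base_bounds base_sq_bounds by (simp add: algebra_simps)
  show "M' (\<beta> + 2 - \<beta> * \<beta>) = 0"
    using step[of "\<beta> + 2 - \<beta> * \<beta>" "3 * \<beta> - \<beta> * \<beta>" "2 * \<beta> + 1 - \<beta> * \<beta>"] out[of "3 * \<beta> - \<beta> * \<beta>"] out[of "2 * \<beta> + 1 - \<beta> * \<beta>"]
      base_cube base_bounds base_sq_bounds by (simp add: algebra_simps)
qed

definition masses :: "real \<Rightarrow> real \<Rightarrow> octuple" where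
  "masses c d = (let M = shifted_mass c d in
     Oct (M (1 - \<beta>)) (M (2 * \<beta> - \<beta> * \<beta> - 1)) (M (\<beta> + 1 - \<beta> * \<beta>)) (M 0)
       (M (2 - \<beta>)) (M (2 * \<beta> - \<beta> * \<beta>)) (M (\<beta> * \<beta> + 1 - 2 * \<beta>)) (M (\<beta> - 1)))"

text \<open>
  The increasing affine map that puts the code word of the letter \<open>k\<close> in front of an expansion.
\<close>
definition branch :: "nat \<Rightarrow> real \<Rightarrow> real" where
  "branch k x = foldr (\<lambda>i y. (y + real i) / \<beta>) (code_word k) x"

lemma branch_simps:
  "branch 0 x = x / \<beta>" "branch (Suc 0) x = (x / \<beta> + 1) / \<beta>"
  "k \<noteq> 0 \<Longrightarrow> k \<noteq> 1 \<Longrightarrow> branch k x = ((x / \<beta> / \<beta> + 1) / \<beta> + 1) / \<beta>"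
  by (simp_all add: branch_def code_word_def)

lemma inverse_base_sq: "1 / \<beta> / \<beta> = \<beta> * \<beta> - \<beta> - 1"
proof -
  have "\<beta> * (\<beta> * (\<beta> * \<beta> - \<beta> - 1)) = \<beta> * (\<beta> * (\<beta> * \<beta>)) - \<beta> * (\<beta> * \<beta>) - \<beta> * \<beta>"
    by (simp add: algebra_simps)
  also have "\<beta> * (\<beta> * (\<beta> * \<beta>)) = 2 * (\<beta> * (\<beta> * \<beta>)) - \<beta> * \<beta> + \<beta>"
    using arg_cong[OF base_cube, of "\<lambda>x. \<beta> * x"] by (simp add: algebra_simps)
  also have "2 * (\<beta> * (\<beta> * \<beta>)) - \<beta> * \<beta> + \<beta> - \<beta> * (\<beta> * \<beta>) - \<beta> * \<beta> = 1"
    using base_cube by simp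
  finally show ?thesis using base_pos by (simp add: field_simps)
qed

text \<open>
  An expansion that starts with a given digit \<open>1\<close> exists only for remainders below \<open>\<beta> - 1\<close>. That the
  last bound holds, with equality for \<open>d = 1\<close>, says that \<open>1100\<close> repeated is the quasi-greedy
  expansion of \<open>1\<close>; hence every code word can be followed by all of \<open>[0, 1[\<close>.
\<close>
lemma branch_room:
  assumes "d \<le> 1"
  shows "d / \<beta> \<le> \<beta> - 1" "d / \<beta> / \<beta> \<le> \<beta> - 1" "(d / \<beta> / \<beta> + 1) / \<beta> \<le> \<beta> - 1"
proof -
  have 1: "1 / \<beta> \<le> \<beta> - 1"
    using base_sq_bounds base_bounds by (simp add: field_simps)
  have "d / \<beta> \<le> 1 / \<beta>" using assms base_pos by (intro divide_right_mono) auto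
  then show "d / \<beta> \<le> \<beta> - 1" using 1 by linarith
  have 2: "d / \<beta> / \<beta> \<le> \<beta> * \<beta> - \<beta> - 1"
    using assms base_pos inverse_base_sq divide_right_mono[of "d / \<beta>" "1 / \<beta>" \<beta>] divide_right_mono[of d 1 \<beta>]
    by simp
  then show "d / \<beta> / \<beta> \<le> \<beta> - 1" using base_sq_bounds base_bounds by linarith
  have "(d / \<beta> / \<beta> + 1) / \<beta> \<le> (\<beta> * (\<beta> - 1)) / \<beta>"
    using 2 base_pos by (intro divide_right_mono) (auto simp: algebra_simps)
  then show "(d / \<beta> / \<beta> + 1) / \<beta> \<le> \<beta> - 1" using base_pos by simp
qed

lemma branch_unit:
  shows branch_nonneg: "0 \<le> x \<Longrightarrow> 0 \<le> branch k x"
    and branch_le_1: "x \<le> 1 \<Longrightarrow> branch k x \<le> 1"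
proof -
  consider "k = 0" | "k = 1" | "k \<noteq> 0" "k \<noteq> 1" by blast
  note cases = this
  show "0 \<le> branch k x" if "0 \<le> x"
    using that base_pos by (cases rule: cases) (auto simp: branch_simps)
  have L: "(y + 1) / \<beta> \<le> 1" if "y \<le> \<beta> - 1" for y
    using that base_pos by simp
  show "branch k x \<le> 1" if "x \<le> 1"
  proof (cases rule: cases)
    case 1
    then show ?thesis using that base_gt_1 by (simp add: branch_simps)
  next
    case 2
    then show ?thesis using L[OF branch_room(1)[OF that]] by (simp add: branch_simps)
  next
    case 3
    then show ?thesis using L[OF branch_room(3)[OF that]] by (simp add: branch_simps)
  qed
qed

lemma masses_branch:
  assumes "0 \<le> c" "d \<le> 1"
  shows "masses (branch k c) (branch k d) = scale (1 / 2 ^ length (code_word k)) (letter_map k (masses c d))"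
proof -
  define c\<^sub>1 d\<^sub>1 where "c\<^sub>1 = c / \<beta>" and "d\<^sub>1 = d / \<beta>"
  define c\<^sub>2 d\<^sub>2 where "c\<^sub>2 = c\<^sub>1 / \<beta>" and "d\<^sub>2 = d\<^sub>1 / \<beta>"
  define c\<^sub>3 d\<^sub>3 where "c\<^sub>3 = (c\<^sub>2 + 1) / \<beta>" and "d\<^sub>3 = (d\<^sub>2 + 1) / \<beta>"
  note defs = c\<^sub>1_def d\<^sub>1_def c\<^sub>2_def d\<^sub>2_def c\<^sub>3_def d\<^sub>3_def
  have c: "0 \<le> c\<^sub>1" "0 \<le> c\<^sub>2" "0 \<le> c\<^sub>3" using assms base_pos by (auto simp: defs)
  have "d\<^sub>1 \<le> \<beta> - 1" "d\<^sub>2 \<le> \<beta> - 1" "d\<^sub>3 \<le> \<beta> - 1"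
    using branch_room[OF assms(2)] by (simp_all only: defs)
  then have d: "d\<^sub>1 \<le> 1" "d\<^sub>2 \<le> 1" "d\<^sub>3 \<le> 1" using base_le_2 by linarith+
  note step0 = shifted_mass_digit_0[OF assms, folded c\<^sub>1_def d\<^sub>1_def]
    and step00 = shifted_mass_digit_0[OF c(1) d(1), folded c\<^sub>2_def d\<^sub>2_def]
    and step10 = shifted_mass_digit_1[OF c(1) d(1)]
    and step100 = shifted_mass_digit_1[OF c(2) d(2), folded c\<^sub>3_def d\<^sub>3_def]
    and step1100 = shifted_mass_digit_1[OF c(3) d(3)]
  consider "k = 0" | "k = 1" | "k \<noteq> 0" "k \<noteq> 1" by blast
  then show ?thesis
  proof cases
    case 1
    then have "branch k c = c\<^sub>1" "branch k d = d\<^sub>1" by (simp_all add: branch_simps defs)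
    then show ?thesis using 1 by (simp add: masses_def Let_def step0 code_word_def)
  next
    case 2
    then have "branch k c = (c\<^sub>1 + 1) / \<beta>" "branch k d = (d\<^sub>1 + 1) / \<beta>"
      by (simp_all add: branch_simps defs)
    then show ?thesis using 2
      by (simp only: masses_def Let_def step10) (simp add: step0 code_word_def add_divide_distrib)
  next
    case 3
    then have "branch k c = (c\<^sub>3 + 1) / \<beta>" "branch k d = (d\<^sub>3 + 1) / \<beta>"
      by (simp_all add: branch_simps defs)
    then show ?thesis using 3
      by (simp only: masses_def Let_def step1100)
        (simp add: step100 step00 step0 code_word_def add_divide_distrib)
  qed
qed

section \<open>Coded cylinders are intervals\<close>

lemma parry_expansion_Cons:
  assumes x: "0 \<le> y" "y < 1" "s \<in> {0, 1}" "y + real s < \<beta>"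
  shows "parry_expansion \<beta> ((y + real s) / \<beta>) = (case_nat s (parry_expansion \<beta> y))"
proof -
  have sx: "(y + real s) / \<beta> \<in> {0..<1}" using x base_pos by auto
  define \<epsilon> where "\<epsilon> = parry_expansion \<beta> y"
  have \<epsilon>: "is_parry_expansion \<beta> y \<epsilon>"
    using theI'[OF ex1_parry_expansion[OF base_gt_1 base_le_2 x(1,2)]]
    by (simp add: \<epsilon>_def parry_expansion_def)
  have "is_parry_expansion \<beta> ((y + real s) / \<beta>) (case_nat s \<epsilon>)"
    unfolding is_parry_expansion_def
  proof (intro conjI allI impI)
    show "case_nat s \<epsilon> n \<in> {0, 1}" for n
      using \<epsilon> x by (auto simp: is_parry_expansion_def split: nat.split)
    fix n :: nat assume "1 \<le> n"
    then obtain m where n: "n = Suc m" by (cases n) auto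
    have sum: "(\<Sum>k<n. real (case_nat s \<epsilon> k) / \<beta> ^ Suc k) = (real s + (\<Sum>k<m. real (\<epsilon> k) / \<beta> ^ Suc k)) / \<beta>"
    proof -
      have "(\<Sum>k<n. real (case_nat s \<epsilon> k) / \<beta> ^ Suc k)
          = real s / \<beta> + (\<Sum>k<m. real (\<epsilon> k) / \<beta> ^ Suc k / \<beta>)"
        unfolding n sum.lessThan_Suc_shift by (simp add: mult.commute)
      then show ?thesis by (simp only: sum_divide_distrib[symmetric] add_divide_distrib)
    qed
    define z where "z = (\<Sum>k<m. real (\<epsilon> k) / \<beta> ^ Suc k)"
    have z: "z \<le> y" "y < z + 1 / \<beta> ^ m"
      using \<epsilon> x by (cases "m = 0"; auto simp: is_parry_expansion_def z_def)+
    have "(real s + z) / \<beta> \<le> (y + real s) / \<beta>"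
      using z base_pos by (intro divide_right_mono) auto
    then show "(\<Sum>k<n. real (case_nat s \<epsilon> k) / \<beta> ^ Suc k) \<le> (y + real s) / \<beta>"
      unfolding sum z_def .
    have "(y + real s) / \<beta> < (real s + z + 1 / \<beta> ^ m) / \<beta>"
      using z base_pos by (intro divide_strict_right_mono) auto
    also have "\<dots> = (real s + z) / \<beta> + 1 / \<beta> ^ n"
      by (simp add: n add_divide_distrib mult.commute)
    finally show "(y + real s) / \<beta> < (\<Sum>k<n. real (case_nat s \<epsilon> k) / \<beta> ^ Suc k) + 1 / \<beta> ^ n"
      unfolding sum z_def .
  qed
  moreover have "\<exists>!\<epsilon>. is_parry_expansion \<beta> ((y + real s) / \<beta>) \<epsilon>"
    using sx by (intro ex1_parry_expansion base_gt_1 base_le_2) auto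
  ultimately show ?thesis unfolding \<epsilon>_def[symmetric] by (subst parry_expansion_def) (rule the1_equality)
qed

lemma parry_cylinder_Cons:
  assumes s: "s \<in> {0, 1}" and w: "parry_cylinder \<beta> w = {c..<d}" and cd: "0 \<le> c" "d \<le> 1" "d + real s \<le> \<beta>"
    and ne: "c < d"
  shows "parry_cylinder \<beta> (s # w) = {(c + real s) / \<beta>..<(d + real s) / \<beta>}"
proof (intro set_eqI iffI)
  fix x assume x: "x \<in> {(c + real s) / \<beta>..<(d + real s) / \<beta>}"
  define y where "y = \<beta> * x - real s"
  have xy: "x = (y + real s) / \<beta>" using base_pos by (simp add: y_def)
  have y: "y \<in> {c..<d}" using x base_pos by (simp add: xy divide_le_cancel divide_less_cancel)
  then have "y \<in> parry_cylinder \<beta> w" using w by simp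
  then show "x \<in> parry_cylinder \<beta> (s # w)"
    using y cd s base_pos unfolding parry_cylinder_def xy
    by (auto simp: parry_expansion_Cons upt_rec[of 0 "Suc _"] map_Suc_upt[symmetric] comp_def simp del: upt_Suc)
next
  fix x assume x: "x \<in> parry_cylinder \<beta> (s # w)"
  then have x01: "0 \<le> x" "x < 1" by (auto simp: parry_cylinder_def)
  define t :: nat where "t = (if \<beta> * x < 1 then 0 else 1)"
  define y where "y = \<beta> * x - real t"
  have bx: "\<beta> * x < \<beta>" using x01 base_pos by simp
  have xy: "x = (y + real t) / \<beta>" using base_pos by (simp add: y_def)
  have y: "0 \<le> y" "y < 1" "t \<in> {0, 1}" "y + real t < \<beta>"
  proof -
    have "\<beta> * x < 2" using bx base_le_2 by linarith
    then show "y < 1" "t \<in> {0, 1}" by (auto simp: y_def t_def)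
    show "0 \<le> y" using x01 base_pos by (auto simp: y_def t_def)
    show "y + real t < \<beta>" using bx by (simp add: y_def)
  qed
  note e = parry_expansion_Cons[OF y, folded xy]
  have "t = s" "map (parry_expansion \<beta> y) [0..<length w] = w"
    using x unfolding parry_cylinder_def
    by (auto simp: e upt_rec[of 0 "Suc _"] map_Suc_upt[symmetric] comp_def simp del: upt_Suc)
  moreover from this have "y \<in> parry_cylinder \<beta> w" using y by (simp add: parry_cylinder_def)
  ultimately show "x \<in> {(c + real s) / \<beta>..<(d + real s) / \<beta>}"
    using w base_pos by (auto simp: xy divide_le_cancel divide_less_cancel)
qed

lemma parry_cylinder_append_code_word:
  assumes w: "parry_cylinder \<beta> w = {c..<d}" and cd: "0 \<le> c" "c < d" "d \<le> 1"
  shows "parry_cylinder \<beta> (code_word k @ w) = {branch k c..<branch k d}"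
proof -
  define c\<^sub>1 d\<^sub>1 where "c\<^sub>1 = c / \<beta>" and "d\<^sub>1 = d / \<beta>"
  define c\<^sub>2 d\<^sub>2 where "c\<^sub>2 = c\<^sub>1 / \<beta>" and "d\<^sub>2 = d\<^sub>1 / \<beta>"
  define c\<^sub>3 d\<^sub>3 where "c\<^sub>3 = (c\<^sub>2 + 1) / \<beta>" and "d\<^sub>3 = (d\<^sub>2 + 1) / \<beta>"
  note defs = c\<^sub>1_def d\<^sub>1_def c\<^sub>2_def d\<^sub>2_def c\<^sub>3_def d\<^sub>3_def
  have room: "d\<^sub>1 \<le> \<beta> - 1" "d\<^sub>2 \<le> \<beta> - 1" "d\<^sub>3 \<le> \<beta> - 1"
    using branch_room[OF cd(3)] by (simp_all only: defs)
  have order: "0 \<le> c\<^sub>1" "c\<^sub>1 < d\<^sub>1" "0 \<le> c\<^sub>2" "c\<^sub>2 < d\<^sub>2" "0 \<le> c\<^sub>3" "c\<^sub>3 < d\<^sub>3"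
    using cd base_pos unfolding defs by (auto intro!: divide_strict_right_mono)
  have le: "d\<^sub>1 \<le> 1" "d\<^sub>2 \<le> 1" "d\<^sub>3 \<le> 1" using room base_le_2 by linarith+
  have 0: "parry_cylinder \<beta> (0 # w) = {c\<^sub>1..<d\<^sub>1}"
    using parry_cylinder_Cons[of 0 w c d] w cd base_gt_1 by (simp add: defs)
  have 00: "parry_cylinder \<beta> (0 # 0 # w) = {c\<^sub>2..<d\<^sub>2}"
    using parry_cylinder_Cons[OF _ 0 order(1) le(1), of 0] order room
    by (simp add: c\<^sub>2_def d\<^sub>2_def)
  have 100: "parry_cylinder \<beta> (1 # 0 # 0 # w) = {c\<^sub>3..<d\<^sub>3}"
    using parry_cylinder_Cons[OF _ 00 order(3) le(2), of 1] order room
    by (simp add: c\<^sub>3_def d\<^sub>3_def)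
  consider "k = 0" | "k = 1" | "k \<noteq> 0" "k \<noteq> 1" by blast
  then show ?thesis
  proof cases
    case 1
    then show ?thesis using 0 by (simp add: branch_simps code_word_def defs)
  next
    case 2
    then show ?thesis using parry_cylinder_Cons[OF _ 0 order(1) le(1), of 1] order room
      by (simp add: branch_simps code_word_def c\<^sub>1_def d\<^sub>1_def)
  next
    case 3
    then show ?thesis using parry_cylinder_Cons[OF _ 100 order(5) le(3), of 1] order room
      by (simp add: branch_simps code_word_def defs)
  qed
qed

lemma coded_cylinder_interval:
  "\<exists>c d. 0 \<le> c \<and> c < d \<and> d \<le> 1 \<and> coded_cylinder \<beta> w = {c..<d} \<and>
     masses c d = scale (1 / 2 ^ length (concat (map code_word w))) (foldr letter_map w (masses 0 1))"
proof (induction w)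
  case Nil
  have "coded_cylinder \<beta> [] = {0..<1}" by (auto simp: coded_cylinder_def parry_cylinder_def)
  then show ?case by (intro exI[of _ 0] exI[of _ 1]) (simp add: scale_1)
next
  case (Cons k w)
  then obtain c d where cd: "0 \<le> c" "c < d" "d \<le> 1" "coded_cylinder \<beta> w = {c..<d}"
    and m: "masses c d = scale (1 / 2 ^ length (concat (map code_word w))) (foldr letter_map w (masses 0 1))"
    by blast
  have "coded_cylinder \<beta> (k # w) = {branch k c..<branch k d}"
    using parry_cylinder_append_code_word[of "concat (map code_word w)" c d k] cd
    by (simp add: coded_cylinder_def)
  moreover have "branch k c < branch k d"
  proof -
    consider "k = 0" | "k = 1" | "k \<noteq> 0" "k \<noteq> 1" by blast
    then show ?thesis using cd(2) base_pos by cases (auto simp: branch_simps divide_strict_right_mono)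
  qed
  moreover have "masses (branch k c) (branch k d)
      = scale (1 / 2 ^ length (concat (map code_word (k # w)))) (foldr letter_map (k # w) (masses 0 1))"
    using masses_branch[OF cd(1,3), of k]
    by (simp add: m letter_map_scale scale_scale power_add)
  ultimately show ?case using branch_nonneg[OF cd(1), of k] branch_le_1[OF cd(3), of k] by blast
qed

text \<open>
  The masses of the translates of the unit interval are comparable to one. The lower bounds come from
  the cylinders of the three letters inside the unit interval, by following the letter
  maps from the fourth entry, which is \<open>1\<close>, to each of the other entries.
\<close>
lemma masses_unit_bounds:
  "octuple_le (scale (1 / 16) ones) (masses 0 1)" "octuple_le (masses 0 1) ones"
proof -
  obtain a b c d e f g h where m: "masses 0 1 = Oct a b c d e f g h" by (cases "masses 0 1")
  have d: "d = 1" using m measure_unit by (simp add: masses_def Let_def shifted_mass_def)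
  have nn: "a \<ge> 0" "b \<ge> 0" "c \<ge> 0" "d \<ge> 0" "e \<ge> 0" "f \<ge> 0" "g \<ge> 0" "h \<ge> 0"
    using m shifted_mass_nonneg by (auto simp: masses_def Let_def)
  have "a \<le> 1" "b \<le> 1" "c \<le> 1" "d \<le> 1" "e \<le> 1" "f \<le> 1" "g \<le> 1" "h \<le> 1"
    using m shifted_mass_le_1 by (auto simp: masses_def Let_def)
  then show "octuple_le (masses 0 1) ones" by (simp add: m ones_def)
  have sub: "octuple_le (scale (1 / 2 ^ length (code_word k)) (letter_map k (masses 0 1))) (masses 0 1)" for k
  proof -
    have "shifted_mass (branch k 0) (branch k 1) a \<le> shifted_mass 0 1 a" for a
      unfolding shifted_mass_def using branch_nonneg[of 0 k] branch_le_1[of 1 k]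
      by (intro finite_measure_mono) auto
    then have "octuple_le (masses (branch k 0) (branch k 1)) (masses 0 1)"
      by (simp add: masses_def Let_def)
    then show ?thesis using masses_branch[of 0 1 k] by simp
  qed
  have "1 / 2 \<le> f" "(c + f) / 2 \<le> e" "e / 2 \<le> g" "g / 2 \<le> h"
    using sub[of 0] nn by (auto simp: m code_word_def d)
  moreover have "1 / 4 \<le> b" "1 / 4 \<le> c"
    using sub[of 1] nn by (auto simp: m code_word_def d)
  moreover have "1 / 16 \<le> a"
    using sub[of 2] nn by (auto simp: m code_word_def d)
  ultimately show "octuple_le (scale (1 / 16) ones) (masses 0 1)"
    using nn by (simp add: m ones_def d)
qed

text \<open>
  By monotonicity of the letter maps, the masses of the unit interval, where the products of letter
  maps are applied, may be replaced by ones.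
\<close>
lemma measure_coded_cylinder:
  defines "N \<equiv> \<lambda>w. 1 / 2 ^ length (concat (map code_word w))"
  shows "N w * central (word_column w) \<le> 16 * measure \<mu> (coded_cylinder \<beta> w)"
    and "measure \<mu> (coded_cylinder \<beta> w) \<le> N w * central (word_column w)"
proof -
  obtain c d where cd: "coded_cylinder \<beta> w = {c..<d}"
    and m: "masses c d = scale (N w) (foldr letter_map w (masses 0 1))"
    using coded_cylinder_interval[of w] unfolding N_def by blast
  have "measure \<mu> (coded_cylinder \<beta> w) = central (masses c d)"
    by (simp add: cd masses_def Let_def shifted_mass_def)
  also have "\<dots> = N w * central (foldr letter_map w (masses 0 1))"
    by (cases "foldr letter_map w (masses 0 1)") (simp add: m)
  finally have eq: "measure \<mu> (coded_cylinder \<beta> w) = N w * central (foldr letter_map w (masses 0 1))" .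
  have N: "N w \<ge> 0" by (simp add: N_def)
  have "octuple_le (scale (1 / 16) (word_column w)) (foldr letter_map w (masses 0 1))"
    using foldr_letter_map_mono[OF masses_unit_bounds(1), of w]
    by (simp add: word_column_def foldr_letter_map_scale)
  then have "central (word_column w) \<le> 16 * central (foldr letter_map w (masses 0 1))"
    by (cases "word_column w"; cases "foldr letter_map w (masses 0 1)") simp
  from mult_left_mono[OF this N]
  show "N w * central (word_column w) \<le> 16 * measure \<mu> (coded_cylinder \<beta> w)" by (simp add: eq)
  have "central (foldr letter_map w (masses 0 1)) \<le> central (word_column w)"
    using foldr_letter_map_mono[OF masses_unit_bounds(2), of w] unfolding word_column_def
    by (cases "foldr letter_map w ones"; cases "foldr letter_map w (masses 0 1)") simp
  from mult_left_mono[OF this N]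
  show "measure \<mu> (coded_cylinder \<beta> w) \<le> N w * central (word_column w)" by (simp add: eq)
qed

end

section \<open>The weak Gibbs property\<close>

text \<open>
  The letter maps leave out the factor \<open>1 / 2\<close> for each binary digit, which is restored here.
\<close>
definition log_mass :: "nat list \<Rightarrow> real" where
  "log_mass w = ln (mass (word_column w)) - real (length (concat (map code_word w))) * ln 2"

lemma summable_dyadic_log: "summable (\<lambda>j. ln (1000 * (real (2 ^ j) + 3)) / 2 ^ j)"
proof (rule summable_comparison_test')
  show "summable (\<lambda>j. ln 4000 * (real (Suc j) * (1 / 2) ^ j))"
    using geometric_deriv_sums[of "1 / 2 :: real"] by (intro summable_mult) (simp add: sums_iff)
  fix j :: nat
  have "1000 * (real (2 ^ j) + 3) \<le> 4000 * 2 ^ j" by simp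
  then have "ln (1000 * (real (2 ^ j) + 3)) \<le> ln (4000 * 2 ^ j)"
    by (subst ln_le_cancel_iff) (auto intro: add_pos_pos)
  also have "\<dots> = ln 4000 + real j * ln 2" by (simp add: ln_mult ln_realpow)
  also have "\<dots> \<le> ln 4000 * real (Suc j)" by (simp add: algebra_simps mult_left_mono)
  finally have "ln (1000 * (real (2 ^ j) + 3)) / 2 ^ j \<le> ln 4000 * real (Suc j) / 2 ^ j"
    by (rule divide_right_mono) simp
  moreover have "0 \<le> ln (1000 * (real (2 ^ j) + 3))" by (intro ln_ge_zero) simp
  ultimately show "norm (ln (1000 * (real (2 ^ j) + 3)) / 2 ^ j) \<le> ln 4000 * (real (Suc j) * (1 / 2) ^ j)"
    by (simp add: power_one_over field_simps)
qed

interpretation log_mass: almost_additive "{0, 1, 2}" log_mass "\<lambda>n. ln (1000 * (real n + 3))"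
proof
  fix u w :: "nat list"
  note pos = mass_column_pos[of u] mass_column_pos[of w] mass_column_pos[of "u @ w"]
  have n: "0 < 1000 * (real (length u) + 3)" by simp
  have "ln (mass (word_column (u @ w))) \<le> ln (mass (word_column u) * mass (word_column w))"
    using mass_append_upper[of u w] pos by (subst ln_le_cancel_iff) auto
  then have "ln (mass (word_column (u @ w))) \<le> ln (mass (word_column u)) + ln (mass (word_column w))"
    using pos by (simp add: ln_mult)
  moreover have "ln (mass (word_column u) * mass (word_column w))
      \<le> ln (1000 * (real (length u) + 3) * mass (word_column (u @ w)))"
    using mass_append_lower[of u w] pos n by (subst ln_le_cancel_iff) (auto simp del: mult_pos_pos intro!: mult_pos_pos)
  then have "ln (mass (word_column u)) + ln (mass (word_column w))
      \<le> ln (1000 * (real (length u) + 3)) + ln (mass (word_column (u @ w)))"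
    using ln_mult_pos[OF n pos(3)] ln_mult_pos[OF pos(1,2)] by simp
  moreover have "0 \<le> ln (1000 * (real (length u) + 3))" by (intro ln_ge_zero) simp
  moreover have "log_mass (u @ w) - log_mass u - log_mass w
      = ln (mass (word_column (u @ w))) - (ln (mass (word_column u)) + ln (mass (word_column w)))"
    by (simp add: log_mass_def algebra_simps)
  ultimately show "\<bar>log_mass (u @ w) - log_mass u - log_mass w\<bar> \<le> ln (1000 * (real (length u) + 3))"
    by linarith
qed (simp_all only: summable_dyadic_log, simp)

lemma (in cubic_base) measure_coded_cylinder_log_mass:
  shows "measure \<mu> (coded_cylinder \<beta> w) \<le> exp (log_mass w)"
    and "exp (log_mass w) \<le> 16384 * (real (length w) + 1) * measure \<mu> (coded_cylinder \<beta> w)"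
proof -
  define N :: real where "N = 1 / 2 ^ length (concat (map code_word w))"
  have N: "N > 0" by (simp add: N_def)
  have "exp (real (length (concat (map code_word w))) * ln 2) = 2 ^ length (concat (map code_word w))"
    by (subst exp_of_nat_mult) simp
  then have G: "exp (log_mass w) = N * mass (word_column w)"
    using mass_column_pos[of w] by (simp only: log_mass_def exp_diff exp_ln N_def) simp
  note bounds = measure_coded_cylinder[of w, folded N_def]
  show "measure \<mu> (coded_cylinder \<beta> w) \<le> exp (log_mass w)"
    using bounds(2) mult_left_mono[OF central_le_mass[of w], of N] N unfolding G by linarith
  have "N * mass (word_column w) \<le> N * (1024 * (real (length w) + 1) * central (word_column w))"
    using mass_le_central[of w] N by (intro mult_left_mono) auto
  also have "\<dots> = 1024 * (real (length w) + 1) * (N * central (word_column w))" by simp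
  also have "\<dots> \<le> 1024 * (real (length w) + 1) * (16 * measure \<mu> (coded_cylinder \<beta> w))"
    using bounds(1) by (intro mult_left_mono) auto
  finally show "exp (log_mass w) \<le> 16384 * (real (length w) + 1) * measure \<mu> (coded_cylinder \<beta> w)"
    unfolding G by (simp add: algebra_simps)
qed

theorem theorem8p6:
  fixes \<beta> :: real
  assumes "\<beta> ^ 3 = 2 * \<beta> ^ 2 - \<beta> + 1"
  shows "\<exists>(\<Psi> :: (nat \<Rightarrow> nat) \<Rightarrow> real) (K :: nat \<Rightarrow> real).
           continuous_map ternary_sequences euclideanreal \<Psi> \<and>
           (\<forall>n\<ge>1. K n > 0) \<and>
           (\<lambda>n. 1 / real n * ln (K n)) \<longlonglongrightarrow> 0 \<and>
           (\<forall>\<xi> \<in> topspace ternary_sequences. \<forall>n\<ge>1.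
              1 / K n \<le> measure (bernoulli_convolution \<beta>) (coded_cylinder \<beta> (map \<xi> [0..<n]))
                          / exp (\<Sum>k<n. \<Psi> ((seq_shift ^^ k) \<xi>)) \<and>
              measure (bernoulli_convolution \<beta>) (coded_cylinder \<beta> (map \<xi> [0..<n]))
                          / exp (\<Sum>k<n. \<Psi> ((seq_shift ^^ k) \<xi>)) \<le> K n)"
proof -
  interpret cubic_base \<beta> using assms by unfold_locales
  let ?\<Psi> = "log_mass.potential"
  obtain e where e: "(\<lambda>n. e n / real n) \<longlonglongrightarrow> 0"
    and approx: "\<And>\<xi> n. range \<xi> \<subseteq> {0, 1, 2} \<Longrightarrow>
      \<bar>log_mass (map \<xi> [0..<n]) - (\<Sum>k<n. ?\<Psi> ((seq_shift ^^ k) \<xi>))\<bar> \<le> e n"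
    using log_mass.potential_approximates by blast
  define K where "K n = exp (e n) * (16384 * (real n + 1))" for n
  have K: "K n > 0" for n by (simp add: K_def)
  have "(\<lambda>n. 1 / real n * ln (K n)) \<longlonglongrightarrow> 0"
  proof -
    have "(\<lambda>n. e n / real n + ln (16384 * (real n + 1)) / real n) \<longlonglongrightarrow> 0 + 0"
      by (intro tendsto_add e) real_asymp
    moreover have "1 / real n * ln (K n) = e n / real n + ln (16384 * (real n + 1)) / real n" for n
      unfolding K_def by (subst ln_mult_pos) (auto simp: add_divide_distrib)
    ultimately show ?thesis by simp
  qed
  moreover have "1 / K n \<le> measure \<mu> (coded_cylinder \<beta> (map \<xi> [0..<n])) / exp (\<Sum>k<n. ?\<Psi> ((seq_shift ^^ k) \<xi>))
      \<and> measure \<mu> (coded_cylinder \<beta> (map \<xi> [0..<n])) / exp (\<Sum>k<n. ?\<Psi> ((seq_shift ^^ k) \<xi>)) \<le> K n"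
    if \<xi>: "\<xi> \<in> topspace ternary_sequences" for \<xi> n
  proof -
    define S where "S = (\<Sum>k<n. ?\<Psi> ((seq_shift ^^ k) \<xi>))"
    define G where "G = log_mass (map \<xi> [0..<n])"
    define M where "M = measure \<mu> (coded_cylinder \<beta> (map \<xi> [0..<n]))"
    define L where "L = 16384 * (real n + 1)"
    have L: "1 \<le> L" by (simp add: L_def)
    have "range \<xi> \<subseteq> {0, 1, 2}"
      using \<xi> by (simp add: ternary_sequences_def PiE_UNIV_domain image_subset_iff_funcset)
    from approx[OF this, of n] have GS: "G \<le> S + e n" "S \<le> G + e n" by (simp_all add: G_def S_def)
    have M: "M \<le> exp G" "exp G \<le> L * M"
      using measure_coded_cylinder_log_mass[of "map \<xi> [0..<n]"] by (simp_all add: M_def G_def L_def)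
    have "M \<le> exp (S + e n) * 1" using M(1) GS(1) by (simp add: order_trans)
    also have "\<dots> \<le> exp (S + e n) * L" using L by (intro mult_left_mono) auto
    finally have "M / exp S \<le> K n" by (simp add: K_def L_def exp_add field_simps)
    moreover have "exp S \<le> exp (e n) * (L * M)"
    proof -
      have "exp S \<le> exp (e n) * exp G" using GS(2) by (simp add: exp_add[symmetric] add.commute)
      also have "\<dots> \<le> exp (e n) * (L * M)" using M(2) by simp
      finally show ?thesis .
    qed
    then have "1 / K n \<le> M / exp S" using K[of n] by (simp add: K_def L_def field_simps)
    ultimately show ?thesis by (simp add: M_def S_def)
  qed
  moreover have "continuous_map ternary_sequences euclideanreal ?\<Psi>"
    unfolding ternary_sequences_def by (rule log_mass.continuous_potential)
  ultimately show ?thesis using K by blast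
qed

end
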